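(* Let $R$ be a finite non-trivial unital ring, $V$ a finite left $R$-module, $n$ a positive integer, $G$ a subgroup of the symmetric group of degree $n$ such that $|G|$ is a unit in $R$, and $\theta=\frac1{|G|}\sum_{g\in G}g\in R[G]$. Let $(M,\Phi)$ be a quadratic pair on $R$ and let $\rho_G=(\theta(V^n),(\rho_G)_M,(\rho_G)_\Phi)$ be a $G$-representation of $(M,\Phi)$. Then the vectors $\mathrm{fwe}_G(\theta C)$, where $C$ ranges over all $G$-codes in $V^n$ that are $G$-isotropic with respect to $\rho_G$, span over $\mathbb{C}$ the subspace of $P(\rho_G)$-invariant vectors of $\mathbb{C}[\theta(V^n)]$; that is, \[ \mathrm{span}_{\mathbb{C}}\{\mathrm{fwe}_G(\theta C)\mid C\text{ is a }G\text{-isotropic code with respect to }\rho_G\}=\mathbb{C}[\theta(V^n)]^{P(\rho_G)} . \]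
   Context: **Codes.** $G$ acts on $V^n$ by $g\cdot v=(v_{g^{-1}(1)},\dots,v_{g^{-1}(n)})$, making $V^n$ a left $R[G]$-module. A $G$-code is an $R[G]$-submodule $C\subset V^n$; $\theta C=\{\theta u\mid u\in C\}$. Let $\alpha_1,\dots,\alpha_t$ be representatives of the $G$-orbits on $\{1,\dots,n\}$. The elements of $\theta(V^n)$ are exactly the vectors of $V^n$ constant on each orbit, and $u\mapsto u_G=(u_{\alpha_1},\dots,u_{\alpha_t})$ is an $R$-module isomorphism $\theta(V^n)\to V^t$. $\mathbb{C}[\theta(V^n)]$ is the complex vector space with basis $(e_u)_{u\in\theta(V^n)}$, and $\mathrm{fwe}_G(\theta C)=\sum_{u\in\theta C}e_u$. **Forms.** All tensor products are over $\mathbb{Z}$. $\mathrm{Bil}(V,\mathbb{Q}/\mathbb{Z})$ is the group of homomorphisms $\beta\colon V\otimes V\to\mathbb{Q}/\mathbb{Z}$. For such $\beta$ put $\beta^n_G(u\otimes v)=\sum_{i=1}^t\beta(u_{\alpha_i}\otimes v_{\alpha_i})$ for $u,v\in\theta(V^n)$, and let $\mathrm{Bil}(\theta(V^n),\mathbb{Q}/\mathbb{Z})_G$ be the set of all $\beta^n_G$; it is a right $(R\otimes R)$-module by $b(r\otimes s)(x\otimes y)=b(rx\otimes sy)$. A quadratic map is $\phi\colon V\to\mathbb{Q}/\mathbb{Z}$ with $\phi(u+v+w)+\phi(u)+\phi(v)+\phi(w)=\phi(u+v)+\phi(v+w)+\phi(w+u)+\phi(0)$ for all $u,v,w\in V$.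 For such $\phi$ put $\phi^n_G(u)=\sum_{i=1}^t\phi(u_{\alpha_i})$ for $u\in\theta(V^n)$, and let $\mathrm{Quad}_0(\theta(V^n),\mathbb{Q}/\mathbb{Z})_G$ be the set of all such maps $\phi^n_G$ with value $0$ at $0$; $R$ acts on it by $q[r](u)=q(ru)$. **Quadratic pairs** (in the sense of Nebe, Rains and Sloane). A twisted $R$-module is a right $(R\otimes R)$-module $M$ with an additive automorphism $\tau$ such that $\tau^2=\mathrm{id}_M$ and $\tau(m(r\otimes s))=\tau(m)(s\otimes r)$. An $R$-qmodule is an abelian group $\Phi$ with a map $R\to\mathrm{End}_{\mathbb{Z}}(\Phi)$, written $\phi\mapsto\phi[r]$, such that $\phi[1]=\phi$, $\phi[r][s]=\phi[rs]$ and $\phi[r+s+t]+\phi[r]+\phi[s]+\phi[t]=\phi[r+s]+\phi[s+t]+\phi[t+r]+\phi[0]$. A twisted $R$-module is an $R$-qmodule by $m[r]=m(r\otimes r)$. A quadratic pair $(M,\Phi)$ on $R$ consists of a twisted $R$-module $M$, an $R$-qmodule $\Phi$, and $R$-qmodule homomorphisms (additive maps commuting with all $[r]$) $\{\!\{\cdot\}\!\}\colon M\to\Phi$ and $\lambda\colon\Phi\to M$ such that, for all $m\in M,\phi\in\Phi,r,s\in R$: $\{\!\{\tau(m)\}\!\}=\{\!\{m\}\!\}$, $\tau(\lambda(\phi))=\lambda(\phi)$, $\lambda(\{\!\{m\}\!\})=m+\tau(m)$, and $\phi[r+s]-\phi[r]-\phi[s]=\{\!\{\lambda(\phi)(r\otimes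 s)\}\!\}$. **$G$-representations.** A $G$-representation $\rho_G=(\theta(V^n),(\rho_G)_M,(\rho_G)_\Phi)$ of $(M,\Phi)$ consists of a right $(R\otimes R)$-module homomorphism $(\rho_G)_M\colon M\to\mathrm{Bil}(\theta(V^n),\mathbb{Q}/\mathbb{Z})_G$ with $(\rho_G)_M(\tau(m))(u\otimes v)=(\rho_G)_M(m)(v\otimes u)$, and an $R$-qmodule homomorphism $(\rho_G)_\Phi\colon\Phi\to\mathrm{Quad}_0(\theta(V^n),\mathbb{Q}/\mathbb{Z})_G$, compatible with the structure maps: $(\rho_G)_\Phi(\{\!\{m\}\!\})(u)=(\rho_G)_M(m)(u\otimes u)$ and $(\rho_G)_M(\lambda(\phi))(u\otimes v)=(\rho_G)_\Phi(\phi)(u+v)-(\rho_G)_\Phi(\phi)(u)-(\rho_G)_\Phi(\phi)(v)$. **Isotropic codes.** A $G$-code $C$ is $G$-isotropic with respect to $\rho_G$ if $(\rho_G)_M(m)(v\otimes u)=0$ for all $m\in M$, $u,v\in\theta C$, and $(\rho_G)_\Phi(\phi)(u)=0$ for all $\phi\in\Phi$, $u\in\theta C$. **The group.** $P(\rho_G)$ is the subgroup of $\mathrm{GL}(\mathbb{C}[\theta(V^n)])$ generated by the maps $m_r$ ($r\in R^*$) and $d_\phi$ ($\phi\in\Phi$), where $m_r(e_u)=e_{ru}$ and $d_\phi(e_u)=\exp(2\pi\sqrt{-1}\,(\rho_G)_\Phi(\phi)(u))\,e_u$. *)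

theory Defs
  imports
    "HOL-Analysis.Cartesian_Space"
    "HOL-Analysis.Complex_Transcendental"
    "HOL-Algebra.Group_Action"
    "HOL-Algebra.Generated_Groups"
    "HOL-Algebra.Free_Abelian_Groups"
    "HOL-Algebra.QuotRing"
begin

text \<open>Rings \<open>R\<close> are types of class \<open>ring_1\<close> (not necessarily commutative, \<open>0 \<noteq> 1\<close>); other abelian
  groups are types of class \<open>ab_group_add\<close>, or additively closed subsets of such types.\<close>

subsection \<open>The group Q/Z\<close>

quotient_type qz = rat / "\<lambda>x y. x - y \<in> (\<int> :: rat set)"
proof (rule equivpI)
  show "reflp (\<lambda>x y. x - y \<in> (\<int> :: rat set))" by (simp add: reflp_def)
  show "symp (\<lambda>x y. x - y \<in> (\<int> :: rat set))"
    by (auto simp: symp_def) (metis Ints_minus minus_diff_eq)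
  show "transp (\<lambda>x y. x - y \<in> (\<int> :: rat set))"
  proof (rule transpI)
    fix x y z :: rat assume "x - y \<in> \<int>" "y - z \<in> \<int>"
    then show "x - z \<in> \<int>" using Ints_add by fastforce
  qed
qed

instantiation qz :: ab_group_add
begin

lift_definition zero_qz :: qz is 0 .

lift_definition plus_qz :: "qz \<Rightarrow> qz \<Rightarrow> qz" is "(+)"
proof -
  fix a b c d :: rat assume "a - b \<in> \<int>" "c - d \<in> \<int>"
  then have "(a - b) + (c - d) \<in> \<int>" by (rule Ints_add)
  then show "(a + c) - (b + d) \<in> \<int>" by (simp add: algebra_simps)
qed

lift_definition uminus_qz :: "qz \<Rightarrow> qz" is uminus
  by (metis Ints_minus minus_diff_eq minus_diff_minus)

lift_definition minus_qz :: "qz \<Rightarrow> qz \<Rightarrow> qz" is "(-)"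
proof -
  fix a b c d :: rat assume "a - b \<in> \<int>" "c - d \<in> \<int>"
  then have "(a - b) - (c - d) \<in> \<int>" by (rule Ints_diff)
  then show "(a - c) - (b - d) \<in> \<int>" by (simp add: algebra_simps)
qed

instance
  by standard (transfer; simp add: algebra_simps)+

end

lift_definition qz_exp :: "qz \<Rightarrow> complex" is "\<lambda>q. exp (2 * of_real pi * \<i> * of_rat q)"
proof -
  fix p q :: rat assume "p - q \<in> \<int>"
  then obtain k :: int where "p - q = of_int k" by (elim Ints_cases)
  then have "p = q + of_int k" by (metis add.commute diff_add_cancel)
  then have "2 * complex_of_real pi * \<i> * of_rat p
      = 2 * complex_of_real pi * \<i> * of_rat q + (of_int (2 * k) * of_real pi) * \<i>"
    by (simp only: of_rat_add of_rat_of_int_eq of_int_mult of_int_numeral distrib_left mult_ac)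
  then show "exp (2 * complex_of_real pi * \<i> * of_rat p) = exp (2 * complex_of_real pi * \<i> * of_rat q)"
    unfolding exp_eq by (intro exI[of _ k]) simp
qed

subsection \<open>Tensor products over the integers\<close>

type_synonym ('a, 'b) tensor = "(('a \<times> 'b) \<Rightarrow>\<^sub>0 int) set"

definition tensor_relators ::
  "'a::ab_group_add set \<Rightarrow> 'b::ab_group_add set \<Rightarrow> (('a \<times> 'b) \<Rightarrow>\<^sub>0 int) set" where
  "tensor_relators A B =
     {frag_of (a + a', b) - frag_of (a, b) - frag_of (a', b) | a a' b. a \<in> A \<and> a' \<in> A \<and> b \<in> B}
   \<union> {frag_of (a, b + b') - frag_of (a, b) - frag_of (a, b') | a b b'. a \<in> A \<and> b \<in> B \<and> b' \<in> B}"

definition tensor_kernel ::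
  "'a::ab_group_add set \<Rightarrow> 'b::ab_group_add set \<Rightarrow> (('a \<times> 'b) \<Rightarrow>\<^sub>0 int) set" where
  "tensor_kernel A B = generate (free_Abelian_group (A \<times> B)) (tensor_relators A B)"

definition tensor_group ::
  "'a::ab_group_add set \<Rightarrow> 'b::ab_group_add set \<Rightarrow> ('a, 'b) tensor monoid" where
  "tensor_group A B = free_Abelian_group (A \<times> B) Mod tensor_kernel A B"

definition pure_tensor ::
  "'a::ab_group_add set \<Rightarrow> 'b::ab_group_add set \<Rightarrow> 'a \<Rightarrow> 'b \<Rightarrow> ('a, 'b) tensor" where
  "pure_tensor A B a b = tensor_kernel A B #>\<^bsub>free_Abelian_group (A \<times> B)\<^esub> frag_of (a, b)"

definition tensor_hom ::
  "'a::ab_group_add set \<Rightarrow> 'b::ab_group_add set \<Rightarrow> (('a, 'b) tensor \<Rightarrow> 'c::ab_group_add) set" where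
  "tensor_hom A B = {f. \<forall>X\<in>carrier (tensor_group A B). \<forall>Y\<in>carrier (tensor_group A B).
     f (X \<otimes>\<^bsub>tensor_group A B\<^esub> Y) = f X + f Y}"

text \<open>The pairing \<open>(R \<otimes> R) \<times> (A \<otimes> A) \<rightarrow> A \<otimes> A\<close> with \<open>(r \<otimes> s)(a \<otimes> b) = ra \<otimes> sb\<close>, computed on
  representatives of cosets (in the style of \<^const>\<open>rcoset_mult\<close>); see \<open>tensor_act_pure\<close>.\<close>

definition frag_act ::
  "('r \<Rightarrow> 'v \<Rightarrow> 'v) \<Rightarrow> (('r \<times> 'r) \<Rightarrow>\<^sub>0 int) \<Rightarrow> (('v \<times> 'v) \<Rightarrow>\<^sub>0 int) \<Rightarrow> (('v \<times> 'v) \<Rightarrow>\<^sub>0 int)" where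
  "frag_act smul x w =
     frag_extend (\<lambda>p. frag_extend (\<lambda>q. frag_of (smul (fst p) (fst q), smul (snd p) (snd q))) w) x"

definition tensor_act ::
  "('r \<Rightarrow> 'v \<Rightarrow> 'v) \<Rightarrow> 'v::ab_group_add set \<Rightarrow> ('r, 'r) tensor \<Rightarrow> ('v, 'v) tensor \<Rightarrow> ('v, 'v) tensor" where
  "tensor_act smul A X W =
     (\<Union>x\<in>X. \<Union>w\<in>W. tensor_kernel A A #>\<^bsub>free_Abelian_group (A \<times> A)\<^esub> frag_act smul x w)"

definition tensor_ring :: "('r::ring_1, 'r) tensor ring" where
  "tensor_ring = \<lparr>carrier = carrier (tensor_group UNIV UNIV),
     monoid.mult = tensor_act (*) UNIV,
     one = pure_tensor UNIV UNIV 1 1,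
     zero = \<one>\<^bsub>tensor_group UNIV UNIV\<^esub>,
     add = (\<otimes>\<^bsub>tensor_group UNIV UNIV\<^esub>)\<rparr>"

subsection \<open>Modules\<close>

definition ring_units :: "'r::ring_1 set" where
  "ring_units = {r. \<exists>s. r * s = 1 \<and> s * r = 1}"

definition ring_inverse :: "'r::ring_1 \<Rightarrow> 'r" where
  "ring_inverse r = (THE s. r * s = 1 \<and> s * r = 1)"

text \<open>The library's \<^locale>\<open>module\<close> requires a commutative ring.\<close>

locale left_module =
  fixes smul :: "'r::ring_1 \<Rightarrow> 'v::ab_group_add \<Rightarrow> 'v"
  assumes smul_add_right: "smul r (x + y) = smul r x + smul r y"
    and smul_add_left: "smul (r + s) x = smul r x + smul s x"
    and smul_smul: "smul r (smul s x) = smul (r * s) x"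
    and smul_one: "smul 1 x = x"

locale right_module =
  fixes K :: "('k, 'z) ring_scheme" (structure)
    and act :: "'m::ab_group_add \<Rightarrow> 'k \<Rightarrow> 'm"
  assumes act_add_left: "x \<in> carrier K \<Longrightarrow> act (m + m') x = act m x + act m' x"
    and act_add_right: "x \<in> carrier K \<Longrightarrow> y \<in> carrier K \<Longrightarrow> act m (x \<oplus> y) = act m x + act m y"
    and act_act: "x \<in> carrier K \<Longrightarrow> y \<in> carrier K \<Longrightarrow> act (act m x) y = act m (x \<otimes> y)"
    and act_one: "act m \<one> = m"

subsection \<open>Well-definedness of the tensor product constructions\<close>

text \<open>The results are \<open>tensor_act_pure\<close>, which shows that \<^const>\<open>tensor_act\<close> is the intended
  pairing, and \<open>tensor_ring_ring\<close>.\<close>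

definition add_closed :: "'a::ab_group_add set \<Rightarrow> bool" where
  "add_closed A \<longleftrightarrow> (\<forall>a\<in>A. \<forall>b\<in>A. a + b \<in> A)"

lemma add_closed_UNIV [simp]: "add_closed UNIV" by (simp add: add_closed_def)


lemma tensor_relators_keys:
  assumes "add_closed A" "add_closed B"
    and "x \<in> tensor_relators A B"
  shows "Poly_Mapping.keys x \<subseteq> A \<times> B"
proof -
  have L: "Poly_Mapping.keys (frag_of p - frag_of q - frag_of r) \<subseteq> A \<times> B"
    if "p \<in> A \<times> B" "q \<in> A \<times> B" "r \<in> A \<times> B" for p q r :: "'a \<times> 'b"
    using that keys_diff[of "frag_of p - frag_of q" "frag_of r"] keys_diff[of "frag_of p" "frag_of q"] by auto
  from assms(3) consider
    a a' b where "x = frag_of (a + a', b) - frag_of (a, b) - frag_of (a', b)" "a \<in> A" "a' \<in> A" "b \<in> B"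
  | a b b' where "x = frag_of (a, b + b') - frag_of (a, b) - frag_of (a, b')" "a \<in> A" "b \<in> B" "b' \<in> B"
    unfolding tensor_relators_def by blast
  then show ?thesis
  proof cases
    case 1 show ?thesis unfolding 1(1) by (rule L) (use 1 assms in \<open>auto simp: add_closed_def\<close>)
  next
    case 2 show ?thesis unfolding 2(1) by (rule L) (use 2 assms in \<open>auto simp: add_closed_def\<close>)
  qed
qed

lemma tensor_kernel_subgroup:
  assumes "add_closed A" "add_closed B"
  shows "subgroup (tensor_kernel A B) (free_Abelian_group (A \<times> B))"
  unfolding tensor_kernel_def
  by (rule group.generate_is_subgroup) (use tensor_relators_keys[OF assms] in auto)

lemma tensor_kernel_normal:
  assumes "add_closed A" "add_closed B"
  shows "tensor_kernel A B \<lhd> free_Abelian_group (A \<times> B)"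
  using tensor_kernel_subgroup[OF assms] abelian_free_Abelian_group comm_group.normal_iff_subgroup by blast

lemma tensor_kernel_closed:
  assumes "add_closed A" "add_closed B"
  shows "0 \<in> tensor_kernel A B"
    "x \<in> tensor_kernel A B \<Longrightarrow> y \<in> tensor_kernel A B \<Longrightarrow> x + y \<in> tensor_kernel A B"
    "x \<in> tensor_kernel A B \<Longrightarrow> y \<in> tensor_kernel A B \<Longrightarrow> x - y \<in> tensor_kernel A B"
    "x \<in> tensor_kernel A B \<Longrightarrow> Poly_Mapping.keys x \<subseteq> A \<times> B"
    "x \<in> tensor_kernel A B \<Longrightarrow> - x \<in> tensor_kernel A B"
proof -
  interpret K: subgroup "tensor_kernel A B" "free_Abelian_group (A \<times> B)"
    by (rule tensor_kernel_subgroup[OF assms])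
  show z: "0 \<in> tensor_kernel A B" using K.one_closed by simp
  show pl: "x \<in> tensor_kernel A B \<Longrightarrow> y \<in> tensor_kernel A B \<Longrightarrow> x + y \<in> tensor_kernel A B" for x y
    using K.m_closed[of x y] by simp
  show ky: "x \<in> tensor_kernel A B \<Longrightarrow> Poly_Mapping.keys x \<subseteq> A \<times> B" for x
    using subsetD[OF K.subset] by (metis carrier_free_Abelian_group_iff)
  show mi: "x \<in> tensor_kernel A B \<Longrightarrow> - x \<in> tensor_kernel A B" for x
    using K.m_inv_closed[of x] ky[of x] inv_free_Abelian_group[of x "A \<times> B"] by simp
  show "x \<in> tensor_kernel A B \<Longrightarrow> y \<in> tensor_kernel A B \<Longrightarrow> x - y \<in> tensor_kernel A B"
    using pl[of x "-y"] mi[of y] by simp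
qed

lemma tensor_coset_eq:
  "tensor_kernel A B #>\<^bsub>free_Abelian_group (A \<times> B)\<^esub> x = {k + x | k. k \<in> tensor_kernel A B}"
  by (auto simp: r_coset_def)

lemma tensor_coset_eq_iff:
  assumes "add_closed A" "add_closed B"
  shows "{k + x | k. k \<in> tensor_kernel A B} = {k + y | k. k \<in> tensor_kernel A B} \<longleftrightarrow> x - y \<in> tensor_kernel A B"
proof
  assume "{k + x | k. k \<in> tensor_kernel A B} = {k + y | k. k \<in> tensor_kernel A B}"
  moreover have "x \<in> {k + x | k. k \<in> tensor_kernel A B}" using tensor_kernel_closed(1)[OF assms] by force
  ultimately show "x - y \<in> tensor_kernel A B" by auto
next
  note kc = tensor_kernel_closed[OF assms]
  assume d: "x - y \<in> tensor_kernel A B"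
  have "\<exists>k'. k + x = k' + y \<and> k' \<in> tensor_kernel A B" if "k \<in> tensor_kernel A B" for k
    by (rule exI[of _ "k + (x - y)"]) (use kc(2)[OF that d] in simp)
  moreover have "\<exists>k'. k + y = k' + x \<and> k' \<in> tensor_kernel A B" if "k \<in> tensor_kernel A B" for k
    by (rule exI[of _ "k - (x - y)"]) (use kc(3)[OF that d] in simp)
  ultimately show "{k + x | k. k \<in> tensor_kernel A B} = {k + y | k. k \<in> tensor_kernel A B}"
    by blast
qed

lemma frag_act_linear [simp]:
  "frag_act smul 0 w = 0" "frag_act smul x 0 = 0"
  "frag_act smul (x - y) w = frag_act smul x w - frag_act smul y w"
  "frag_act smul (x + y) w = frag_act smul x w + frag_act smul y w"
  "frag_act smul x (w - z) = frag_act smul x w - frag_act smul x z"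
  "frag_act smul x (w + z) = frag_act smul x w + frag_act smul x z"
  "frag_act smul (frag_of p) (frag_of q) = frag_of (smul (fst p) (fst q), smul (snd p) (snd q))"
  "frag_act smul (- x) w = - frag_act smul x w"
  "frag_act smul x (- w) = - frag_act smul x w"
proof -
  have D: "frag_extend (\<lambda>p. f p - g p) x = frag_extend f x - frag_extend g x" 
    for f g :: "'p \<Rightarrow> 'q \<Rightarrow>\<^sub>0 int" and x
    using subset_UNIV by (induction x rule: frag_induction) (auto simp: frag_extend_diff)
  have Z: "frag_extend (\<lambda>p. 0 :: 'q \<Rightarrow>\<^sub>0 int) x = 0" for x :: "'p \<Rightarrow>\<^sub>0 int"
    by (simp add: frag_extend_eq_0)
  show "frag_act smul 0 w = 0" "frag_act smul x 0 = 0"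
    "frag_act smul (x - y) w = frag_act smul x w - frag_act smul y w"
    "frag_act smul (x + y) w = frag_act smul x w + frag_act smul y w"
    "frag_act smul (- x) w = - frag_act smul x w"
    "frag_act smul (frag_of p) (frag_of q) = frag_of (smul (fst p) (fst q), smul (snd p) (snd q))"
    by (auto simp: frag_act_def frag_extend_diff frag_extend_add frag_extend_minus Z)
  show M: "frag_act smul x (w - z) = frag_act smul x w - frag_act smul x z" for w z
    by (auto simp: frag_act_def frag_extend_diff D)
  show N: "frag_act smul x (- w) = - frag_act smul x w" for w
    using M[of 0 w] by (simp add: frag_act_def Z)
  show "frag_act smul x (w + z) = frag_act smul x w + frag_act smul x z"
    using M[of w "-z"] N[of z] by simp
qed

locale act_set = left_module smul for smul :: "'r::ring_1 \<Rightarrow> 'v::ab_group_add \<Rightarrow> 'v" +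
  fixes A :: "'v set"
  assumes A_zero: "0 \<in> A" and A_add: "a \<in> A \<Longrightarrow> a' \<in> A \<Longrightarrow> a + a' \<in> A" and A_smul: "a \<in> A \<Longrightarrow> smul r a \<in> A"
begin

lemma add_closed_A: "add_closed A" by (simp add: add_closed_def A_add)

lemmas kernel_A = tensor_kernel_closed[OF add_closed_A add_closed_A]
lemmas kernel_RR = tensor_kernel_closed[OF add_closed_UNIV add_closed_UNIV, where ?'a='r and ?'b='r]

lemma relator_in_kernel: "x \<in> tensor_relators A A \<Longrightarrow> x \<in> tensor_kernel A A"
  by (simp add: generate.incl tensor_kernel_def)

lemma act_kernel1:
  assumes "x \<in> tensor_kernel UNIV UNIV" "Poly_Mapping.keys w \<subseteq> A \<times> A"
  shows "frag_act smul x w \<in> tensor_kernel A A"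
proof -
  have R: "frag_act smul x (frag_of p) \<in> tensor_kernel A A"
    if "x \<in> tensor_relators UNIV UNIV" "p \<in> A \<times> A" for x p
  proof (rule relator_in_kernel)
    from that(1) consider
      a a' b where "x = frag_of (a + a', b) - frag_of (a, b) - frag_of (a', b)"
    | a b b' where "x = frag_of (a, b + b') - frag_of (a, b) - frag_of (a, b')"
      unfolding tensor_relators_def by blast
    then show "frag_act smul x (frag_of p) \<in> tensor_relators A A"
    proof cases
      case 1 then show ?thesis unfolding tensor_relators_def
        by (intro UnI1 CollectI exI[of _ "smul a (fst p)"] exI[of _ "smul a' (fst p)"] exI[of _ "smul b (snd p)"])
          (use that A_smul in \<open>auto simp: smul_add_left\<close>)
    next
      case 2 then show ?thesis unfolding tensor_relators_def
        by (intro UnI2 CollectI exI[of _ "smul a (fst p)"] exI[of _ "smul b (snd p)"] exI[of _ "smul b' (snd p)"])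
          (use that A_smul in \<open>auto simp: smul_add_left\<close>)
    qed
  qed
  have 1: "frag_act smul x (frag_of p) \<in> tensor_kernel A A" if p: "p \<in> A \<times> A" for p
    using assms(1) unfolding tensor_kernel_def[of UNIV UNIV]
  proof (induction x rule: generate.induct)
    case one then show ?case by (simp add: kernel_A)
  next
    case (incl h) then show ?case using R p by blast
  next
    case (inv h)
    have "inv\<^bsub>free_Abelian_group (UNIV \<times> UNIV)\<^esub> h = - h" by (simp add: inv_free_Abelian_group)
    then show ?case using R[OF inv p] kernel_A(5) by simp
  next
    case (eng h1 h2) then show ?case by (simp add: kernel_A)
  qed
  show ?thesis using assms(2)
    by (induction w rule: frag_induction) (auto simp: 1 kernel_A)
qed

lemma act_kernel2:
  assumes "w \<in> tensor_kernel A A"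
  shows "frag_act smul x w \<in> tensor_kernel A A"
proof -
  have R: "frag_act smul (frag_of p) w \<in> tensor_kernel A A"
    if "w \<in> tensor_relators A A" for w p
  proof (rule relator_in_kernel)
    from that(1) consider
      a a' b where "w = frag_of (a + a', b) - frag_of (a, b) - frag_of (a', b)" "a \<in> A" "a' \<in> A" "b \<in> A"
    | a b b' where "w = frag_of (a, b + b') - frag_of (a, b) - frag_of (a, b')" "a \<in> A" "b \<in> A" "b' \<in> A"
      unfolding tensor_relators_def by blast
    then show "frag_act smul (frag_of p) w \<in> tensor_relators A A"
    proof cases
      case 1 then show ?thesis unfolding tensor_relators_def
        by (intro UnI1 CollectI exI[of _ "smul (fst p) a"] exI[of _ "smul (fst p) a'"] exI[of _ "smul (snd p) b"])
          (use A_smul in \<open>auto simp: smul_add_right\<close>)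
    next
      case 2 then show ?thesis unfolding tensor_relators_def
        by (intro UnI2 CollectI exI[of _ "smul (fst p) a"] exI[of _ "smul (snd p) b"] exI[of _ "smul (snd p) b'"])
          (use A_smul in \<open>auto simp: smul_add_right\<close>)
    qed
  qed
  have 1: "frag_act smul (frag_of p) w \<in> tensor_kernel A A" for p
    using assms unfolding tensor_kernel_def[of A A]
  proof (induction w rule: generate.induct)
    case one then show ?case using kernel_A(1) by (simp add: tensor_kernel_def)
  next
    case (incl h) then show ?case using R by (simp add: tensor_kernel_def)
  next
    case (inv h)
    have "h \<in> tensor_kernel A A" using inv relator_in_kernel by simp
    then have "inv\<^bsub>free_Abelian_group (A \<times> A)\<^esub> h = - h" using kernel_A(4) by (simp add: inv_free_Abelian_group)
    then show ?case using kernel_A(5)[OF R[OF inv]] by (simp add: tensor_kernel_def)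
  next
    case (eng h1 h2) then show ?case using kernel_A(2) by (simp add: tensor_kernel_def)
  qed
  show ?thesis using subset_UNIV[of "Poly_Mapping.keys x"]
    by (induction x rule: frag_induction) (auto simp: 1 kernel_A)
qed

lemma tensor_act_coset:
  assumes "Poly_Mapping.keys w \<subseteq> A \<times> A"
  shows "tensor_act smul A (tensor_kernel UNIV UNIV #>\<^bsub>free_Abelian_group (UNIV \<times> UNIV)\<^esub> x)
       (tensor_kernel A A #>\<^bsub>free_Abelian_group (A \<times> A)\<^esub> w)
     = tensor_kernel A A #>\<^bsub>free_Abelian_group (A \<times> A)\<^esub> frag_act smul x w"
proof -
  let ?C = "\<lambda>w. {k + w | k. k \<in> tensor_kernel A A}"
  have "?C (frag_act smul (k + x) (l + w)) = ?C (frag_act smul x w)"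
    if k: "k \<in> tensor_kernel UNIV UNIV" and l: "l \<in> tensor_kernel A A" for k l
  proof -
    have "frag_act smul (k + x) (l + w) - frag_act smul x w
       = frag_act smul k l + frag_act smul k w + frag_act smul x l" by simp
    also have "\<dots> \<in> tensor_kernel A A"
      by (intro kernel_A act_kernel1[OF k] act_kernel2 l assms)
    finally show ?thesis using tensor_coset_eq_iff[OF add_closed_A add_closed_A] by blast
  qed
  note E = this
  have "tensor_act smul A {k + x | k. k \<in> tensor_kernel UNIV UNIV} (?C w) =
    (\<Union>k\<in>tensor_kernel UNIV UNIV. \<Union>l\<in>tensor_kernel A A. ?C (frag_act smul (k + x) (l + w)))"
    unfolding tensor_act_def tensor_coset_eq Setcompr_eq_image UN_simps(10) ..
  also have "\<dots> = (\<Union>k\<in>tensor_kernel (UNIV::'r set) (UNIV::'r set). \<Union>l\<in>tensor_kernel A A. ?C (frag_act smul x w))"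
    by (rule arg_cong[of _ _ Union], rule image_cong[OF refl], rule arg_cong[of _ _ Union], rule image_cong[OF refl], rule E)
  also have "\<dots> = (\<Union>k\<in>tensor_kernel (UNIV::'r set) (UNIV::'r set). ?C (frag_act smul x w))"
    by (rule arg_cong[of _ _ Union], rule image_cong[OF refl]) (use kernel_A(1) in \<open>simp only: UN_constant split: if_splits, blast\<close>)
  also have "\<dots> = ?C (frag_act smul x w)"
    using kernel_RR(1) by (subst UN_constant) auto
  finally show ?thesis unfolding tensor_coset_eq .
qed

lemma tensor_act_pure:
  assumes "a \<in> A" "b \<in> A"
  shows "tensor_act smul A (pure_tensor UNIV UNIV r s) (pure_tensor A A a b)
    = pure_tensor A A (smul r a) (smul s b)"
  unfolding pure_tensor_def by (subst tensor_act_coset) (use assms in auto)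

end

abbreviation coset_RR :: "('r::ring_1 \<times> 'r \<Rightarrow>\<^sub>0 int) \<Rightarrow> _" where
  "coset_RR x \<equiv> tensor_kernel UNIV UNIV #>\<^bsub>free_Abelian_group (UNIV \<times> UNIV)\<^esub> x"

lemma coset_RR_add: "coset_RR x \<otimes>\<^bsub>tensor_group UNIV UNIV\<^esub> coset_RR y = coset_RR (x + y)"
proof -
  interpret normal "tensor_kernel UNIV UNIV" "free_Abelian_group (UNIV \<times> UNIV)"
    by (rule tensor_kernel_normal) auto
  show ?thesis unfolding tensor_group_def using rcos_sum[of x y] by (simp add: FactGroup_def)
qed

lemma coset_RR_zero: "\<one>\<^bsub>tensor_group UNIV UNIV\<^esub> = coset_RR 0"
  unfolding tensor_group_def tensor_coset_eq one_FactGroup by simp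

lemma frag_act_assoc: "frag_act (*) (frag_act (*) x y) z = frag_act (*) x (frag_act (*) y z)"
  for x y z :: "'r::ring_1 \<times> 'r \<Rightarrow>\<^sub>0 int"
proof -
  have 1: "frag_act (*) (frag_act (*) (frag_of p) (frag_of q)) z = frag_act (*) (frag_of p) (frag_act (*) (frag_of q) z)"
    for p q :: "'r \<times> 'r"
    using subset_UNIV[of "Poly_Mapping.keys z"] by (induction z rule: frag_induction) (auto simp: mult.assoc)
  have 2: "frag_act (*) (frag_act (*) (frag_of p) y) z = frag_act (*) (frag_of p) (frag_act (*) y z)"
    for p :: "'r \<times> 'r"
    using subset_UNIV[of "Poly_Mapping.keys y"] by (induction y rule: frag_induction) (use 1 in auto)
  show ?thesis
    using subset_UNIV[of "Poly_Mapping.keys x"] by (induction x rule: frag_induction) (use 2 in auto)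
qed

lemma frag_act_1: "frag_act (*) (frag_of (1,1)) x = x"  "frag_act (*) x (frag_of (1,1)) = x"
  for x :: "'r::ring_1 \<times> 'r \<Rightarrow>\<^sub>0 int"
  using subset_UNIV[of "Poly_Mapping.keys x"] by (induction x rule: frag_induction) auto

lemma tensor_ring_ring: "ring (tensor_ring :: ('r::ring_1, 'r) tensor ring)"
proof -
  interpret S: act_set "(*) :: 'r \<Rightarrow> 'r \<Rightarrow> 'r" UNIV
    by unfold_locales (auto simp: algebra_simps)
  let ?R = "tensor_ring :: ('r::ring_1, 'r) tensor ring"
  have car: "carrier ?R = range coset_RR"
    by (auto simp: tensor_ring_def tensor_group_def carrier_FactGroup)
  have add: "coset_RR x \<oplus>\<^bsub>?R\<^esub> coset_RR y = coset_RR (x + y)" for x y by (simp add: tensor_ring_def coset_RR_add[simplified])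
  have mul: "coset_RR x \<otimes>\<^bsub>?R\<^esub> coset_RR y = coset_RR (frag_act (*) x y)" for x y
    using S.tensor_act_coset[of y x] by (simp add: tensor_ring_def)
  have zer: "\<zero>\<^bsub>?R\<^esub> = coset_RR 0" by (simp add: tensor_ring_def coset_RR_zero[simplified])
  have one: "\<one>\<^bsub>?R\<^esub> = coset_RR (frag_of (1,1))" by (simp add: tensor_ring_def pure_tensor_def)
  show ?thesis
  proof (rule ringI)
    show "abelian_group ?R"
    proof (rule abelian_groupI)
      fix x assume "x \<in> carrier ?R"
      then obtain a where "x = coset_RR a" unfolding car by blast
      then have "coset_RR (-a) \<oplus>\<^bsub>?R\<^esub> x = \<zero>\<^bsub>?R\<^esub>" unfolding zer \<open>x = coset_RR a\<close> add by simp
      then show "\<exists>y\<in>carrier ?R. y \<oplus>\<^bsub>?R\<^esub> x = \<zero>\<^bsub>?R\<^esub>" unfolding car by blast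
    qed (unfold car zer, auto simp only: add add_0_left add_0_right add.assoc add.commute add.left_commute intro!: rangeI elim!: rangeE)
    show "Group.monoid ?R"
    proof (rule monoidI)
      fix x y z assume "x \<in> carrier ?R" "y \<in> carrier ?R" "z \<in> carrier ?R"
      then obtain a b c where E: "x = coset_RR a" "y = coset_RR b" "z = coset_RR c" unfolding car by blast
      show "x \<otimes>\<^bsub>?R\<^esub> y \<otimes>\<^bsub>?R\<^esub> z = x \<otimes>\<^bsub>?R\<^esub> (y \<otimes>\<^bsub>?R\<^esub> z)" unfolding E mul frag_act_assoc ..
    next
      fix x y assume "x \<in> carrier ?R" "y \<in> carrier ?R" 
      then obtain a b where E: "x = coset_RR a" "y = coset_RR b" unfolding car by blast
      show "x \<otimes>\<^bsub>?R\<^esub> y \<in> carrier ?R" unfolding E mul car by (rule rangeI)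
    next
      show "\<one>\<^bsub>?R\<^esub> \<in> carrier ?R" unfolding one car by (rule rangeI)
    next
      fix x assume "x \<in> carrier ?R"
      then obtain a where E: "x = coset_RR a" unfolding car by blast
      show "\<one>\<^bsub>?R\<^esub> \<otimes>\<^bsub>?R\<^esub> x = x" unfolding E one mul frag_act_1 ..
      show "x \<otimes>\<^bsub>?R\<^esub> \<one>\<^bsub>?R\<^esub> = x" unfolding E one mul frag_act_1 ..
    qed
  next
    fix x y z assume "x \<in> carrier ?R" "y \<in> carrier ?R" "z \<in> carrier ?R"
    then obtain a b c where E: "x = coset_RR a" "y = coset_RR b" "z = coset_RR c" unfolding car by blast
    show "(x \<oplus>\<^bsub>?R\<^esub> y) \<otimes>\<^bsub>?R\<^esub> z = x \<otimes>\<^bsub>?R\<^esub> z \<oplus>\<^bsub>?R\<^esub> y \<otimes>\<^bsub>?R\<^esub> z"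
      unfolding E mul add frag_act_linear ..
    show "z \<otimes>\<^bsub>?R\<^esub> (x \<oplus>\<^bsub>?R\<^esub> y) = z \<otimes>\<^bsub>?R\<^esub> x \<oplus>\<^bsub>?R\<^esub> z \<otimes>\<^bsub>?R\<^esub> y"
      unfolding E mul add frag_act_linear ..
  qed
qed

subsection \<open>Quadratic pairs\<close>

abbreviation pure_RR :: "'r::ring_1 \<Rightarrow> 'r \<Rightarrow> ('r, 'r) tensor" where
  "pure_RR \<equiv> pure_tensor UNIV UNIV"

locale twisted_module = right_module tensor_ring mact
  for mact :: "'m::ab_group_add \<Rightarrow> ('r::ring_1, 'r) tensor \<Rightarrow> 'm" +
  fixes \<tau> :: "'m \<Rightarrow> 'm"
  assumes tau_add: "\<tau> (m + m') = \<tau> m + \<tau> m'"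
    and tau_tau: "\<tau> (\<tau> m) = m"
    and tau_act: "\<tau> (mact m (pure_RR r s)) = mact (\<tau> m) (pure_RR s r)"

locale qmodule =
  fixes qact :: "'p::ab_group_add \<Rightarrow> 'r::ring_1 \<Rightarrow> 'p"
  assumes qact_add: "qact (\<phi> + \<psi>) r = qact \<phi> r + qact \<psi> r"
    and qact_one: "qact \<phi> 1 = \<phi>"
    and qact_mult: "qact (qact \<phi> r) s = qact \<phi> (r * s)"
    and qact_quadratic: "qact \<phi> (r + s + t) + qact \<phi> r + qact \<phi> s + qact \<phi> t
      = qact \<phi> (r + s) + qact \<phi> (s + t) + qact \<phi> (t + r) + qact \<phi> 0"

locale quadratic_pair = twisted_module mact \<tau> + qmodule qact
  for mact :: "'m::ab_group_add \<Rightarrow> ('r::ring_1, 'r) tensor \<Rightarrow> 'm"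
    and \<tau> :: "'m \<Rightarrow> 'm"
    and qact :: "'p::ab_group_add \<Rightarrow> 'r \<Rightarrow> 'p" +
  fixes brace :: "'m \<Rightarrow> 'p" and lam :: "'p \<Rightarrow> 'm"
  assumes brace_add: "brace (m + m') = brace m + brace m'"
    and brace_act: "brace (mact m (pure_RR r r)) = qact (brace m) r"
    and lam_add: "lam (\<phi> + \<psi>) = lam \<phi> + lam \<psi>"
    and lam_act: "lam (qact \<phi> r) = mact (lam \<phi>) (pure_RR r r)"
    and brace_tau: "brace (\<tau> m) = brace m"
    and tau_lam: "\<tau> (lam \<phi>) = lam \<phi>"
    and lam_brace: "lam (brace m) = m + \<tau> m"
    and brace_lam: "qact \<phi> (r + s) - qact \<phi> r - qact \<phi> s = brace (mact (lam \<phi>) (pure_RR r s))"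

subsection \<open>Codes\<close>

text \<open>\<open>V\<^sup>n\<close> is \<^typ>\<open>'v ^ 'n\<close> with \<open>n = CARD('n)\<close>, and the symmetric group of degree \<open>n\<close> is
  \<^term>\<open>BijGroup (UNIV :: 'n set)\<close>.\<close>

definition vec_smul :: "('r \<Rightarrow> 'v \<Rightarrow> 'v) \<Rightarrow> 'r \<Rightarrow> 'v ^ 'n \<Rightarrow> 'v ^ 'n" where
  "vec_smul smul r v = (\<chi> i. smul r (v $ i))"

definition perm_act :: "('n \<Rightarrow> 'n) \<Rightarrow> 'v ^ 'n \<Rightarrow> 'v ^ 'n" where
  "perm_act g v = (\<chi> i. v $ inv_into UNIV g i)"

definition group_ring :: "('n \<Rightarrow> 'n) set \<Rightarrow> (('n \<Rightarrow> 'n) \<Rightarrow> 'r::ring_1) set" where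
  "group_ring G = {a. \<forall>g. g \<notin> G \<longrightarrow> a g = 0}"

definition group_ring_act ::
  "('r::ring_1 \<Rightarrow> 'v::ab_group_add \<Rightarrow> 'v) \<Rightarrow> ('n::finite \<Rightarrow> 'n) set \<Rightarrow> (('n \<Rightarrow> 'n) \<Rightarrow> 'r) \<Rightarrow> 'v ^ 'n \<Rightarrow> 'v ^ 'n"
  where "group_ring_act smul G a v = (\<Sum>g\<in>G. vec_smul smul (a g) (perm_act g v))"

definition theta :: "('n::finite \<Rightarrow> 'n) set \<Rightarrow> ('n \<Rightarrow> 'n) \<Rightarrow> 'r::ring_1" where
  "theta G = (\<lambda>g. if g \<in> G then ring_inverse (of_nat (card G)) else 0)"

definition G_code ::
  "('r::ring_1 \<Rightarrow> 'v::ab_group_add \<Rightarrow> 'v) \<Rightarrow> ('n::finite \<Rightarrow> 'n) set \<Rightarrow> ('v ^ 'n) set \<Rightarrow> bool" where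
  "G_code smul G C \<longleftrightarrow> 0 \<in> C \<and> (\<forall>u\<in>C. \<forall>v\<in>C. u + v \<in> C)
     \<and> (\<forall>a\<in>group_ring G. \<forall>v\<in>C. group_ring_act smul G a v \<in> C)"

definition theta_image ::
  "('r::ring_1 \<Rightarrow> 'v::ab_group_add \<Rightarrow> 'v) \<Rightarrow> ('n::finite \<Rightarrow> 'n) set \<Rightarrow> ('v ^ 'n) set \<Rightarrow> ('v ^ 'n) set" where
  "theta_image smul G C = group_ring_act smul G (theta G) ` C"

definition orbit_representatives :: "('n \<Rightarrow> 'n) set \<Rightarrow> nat \<Rightarrow> (nat \<Rightarrow> 'n) \<Rightarrow> bool" where
  "orbit_representatives G t \<alpha> \<longleftrightarrow>
     bij_betw (\<lambda>k. orbit (BijGroup UNIV \<lparr>carrier := G\<rparr>) (\<lambda>g. g) (\<alpha> k)) {1..t}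
       (orbits (BijGroup UNIV \<lparr>carrier := G\<rparr>) UNIV (\<lambda>g. g))"

subsection \<open>Forms\<close>

definition quadratic_map :: "('v::ab_group_add \<Rightarrow> 'c::ab_group_add) \<Rightarrow> bool" where
  "quadratic_map \<phi> \<longleftrightarrow> (\<forall>u v w. \<phi> (u + v + w) + \<phi> u + \<phi> v + \<phi> w
     = \<phi> (u + v) + \<phi> (v + w) + \<phi> (w + u) + \<phi> 0)"

text \<open>Maps with domain \<open>T = \<theta>(V\<^sup>n)\<close> or \<open>T \<otimes> T\<close> are total functions of which only the values on
  that domain matter.\<close>

definition Bil_G :: "('v::ab_group_add ^ 'n) set \<Rightarrow> nat \<Rightarrow> (nat \<Rightarrow> 'n) \<Rightarrow>
    (('v ^ 'n, 'v ^ 'n) tensor \<Rightarrow> qz) set" where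
  "Bil_G T t \<alpha> = {b \<in> tensor_hom T T. \<exists>\<beta>\<in>tensor_hom UNIV UNIV. \<forall>u\<in>T. \<forall>v\<in>T.
     b (pure_tensor T T u v) = (\<Sum>k=1..t. \<beta> (pure_tensor UNIV UNIV (u $ \<alpha> k) (v $ \<alpha> k)))}"

definition Quad0_G :: "('v::ab_group_add ^ 'n) set \<Rightarrow> nat \<Rightarrow> (nat \<Rightarrow> 'n) \<Rightarrow> ('v ^ 'n \<Rightarrow> qz) set" where
  "Quad0_G T t \<alpha> = {q. q 0 = 0 \<and>
     (\<exists>\<phi>. quadratic_map \<phi> \<and> (\<forall>u\<in>T. q u = (\<Sum>k=1..t. \<phi> (u $ \<alpha> k))))}"

abbreviation theta_space ::
  "('r::ring_1 \<Rightarrow> 'v::ab_group_add \<Rightarrow> 'v) \<Rightarrow> ('n::finite \<Rightarrow> 'n) set \<Rightarrow> ('v ^ 'n) set" where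
  "theta_space smul G \<equiv> theta_image smul G UNIV"

abbreviation theta_tensor ::
  "('r::ring_1 \<Rightarrow> 'v::ab_group_add \<Rightarrow> 'v) \<Rightarrow> ('n::finite \<Rightarrow> 'n) set \<Rightarrow>
    'v ^ 'n \<Rightarrow> 'v ^ 'n \<Rightarrow> ('v ^ 'n, 'v ^ 'n) tensor" where
  "theta_tensor smul G \<equiv> pure_tensor (theta_space smul G) (theta_space smul G)"

locale G_representation =
  left_module smul + quadratic_pair mact \<tau> qact brace lam
  for smul :: "'r::ring_1 \<Rightarrow> 'v::ab_group_add \<Rightarrow> 'v"
    and mact :: "'m::ab_group_add \<Rightarrow> ('r, 'r) tensor \<Rightarrow> 'm" and \<tau> :: "'m \<Rightarrow> 'm"
    and qact :: "'p::ab_group_add \<Rightarrow> 'r \<Rightarrow> 'p" and brace :: "'m \<Rightarrow> 'p" and lam :: "'p \<Rightarrow> 'm" +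
  fixes G :: "('n::finite \<Rightarrow> 'n) set" and t :: nat and \<alpha> :: "nat \<Rightarrow> 'n"
    and \<rho>M :: "'m \<Rightarrow> ('v ^ 'n, 'v ^ 'n) tensor \<Rightarrow> qz" and \<rho>\<Phi> :: "'p \<Rightarrow> 'v ^ 'n \<Rightarrow> qz"
  assumes rhoM_in: "\<rho>M m \<in> Bil_G (theta_space smul G) t \<alpha>"
    and rhoM_add: "w \<in> carrier (tensor_group (theta_space smul G) (theta_space smul G)) \<Longrightarrow>
      \<rho>M (m + m') w = \<rho>M m w + \<rho>M m' w"
    and rhoM_act: "x \<in> carrier tensor_ring \<Longrightarrow>
      w \<in> carrier (tensor_group (theta_space smul G) (theta_space smul G)) \<Longrightarrow>
      \<rho>M (mact m x) w = \<rho>M m (tensor_act (vec_smul smul) (theta_space smul G) x w)"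
    and rhoM_tau: "u \<in> theta_space smul G \<Longrightarrow> v \<in> theta_space smul G \<Longrightarrow>
      \<rho>M (\<tau> m) (theta_tensor smul G u v) = \<rho>M m (theta_tensor smul G v u)"
    and rhoPhi_in: "\<rho>\<Phi> \<phi> \<in> Quad0_G (theta_space smul G) t \<alpha>"
    and rhoPhi_add: "u \<in> theta_space smul G \<Longrightarrow> \<rho>\<Phi> (\<phi> + \<psi>) u = \<rho>\<Phi> \<phi> u + \<rho>\<Phi> \<psi> u"
    and rhoPhi_act: "u \<in> theta_space smul G \<Longrightarrow> \<rho>\<Phi> (qact \<phi> r) u = \<rho>\<Phi> \<phi> (vec_smul smul r u)"
    and rho_brace: "u \<in> theta_space smul G \<Longrightarrow>
      \<rho>\<Phi> (brace m) u = \<rho>M m (theta_tensor smul G u u)"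
    and rho_lam: "u \<in> theta_space smul G \<Longrightarrow> v \<in> theta_space smul G \<Longrightarrow>
      \<rho>M (lam \<phi>) (theta_tensor smul G u v) = \<rho>\<Phi> \<phi> (u + v) - \<rho>\<Phi> \<phi> u - \<rho>\<Phi> \<phi> v"

definition G_isotropic ::
  "('r::ring_1 \<Rightarrow> 'v::ab_group_add \<Rightarrow> 'v) \<Rightarrow> ('n::finite \<Rightarrow> 'n) set \<Rightarrow>
    ('m \<Rightarrow> ('v ^ 'n, 'v ^ 'n) tensor \<Rightarrow> qz) \<Rightarrow> ('p \<Rightarrow> 'v ^ 'n \<Rightarrow> qz) \<Rightarrow> ('v ^ 'n) set \<Rightarrow> bool" where
  "G_isotropic smul G \<rho>M \<rho>\<Phi> C \<longleftrightarrow>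
     (\<forall>m. \<forall>u\<in>theta_image smul G C. \<forall>v\<in>theta_image smul G C. \<rho>M m (theta_tensor smul G v u) = 0)
   \<and> (\<forall>\<phi>. \<forall>u\<in>theta_image smul G C. \<rho>\<Phi> \<phi> u = 0)"

subsection \<open>The group and its invariants\<close>

text \<open>For a subset \<open>S\<close> of a finite type \<open>'x\<close>, the space with basis \<open>(e\<^sub>u)\<^sub>u\<^sub>\<in>\<^sub>S\<close> is realised inside
  \<^typ>\<open>complex ^ 'x\<close>, with \<open>e\<^sub>u = axis u 1\<close>.\<close>

definition complex_space :: "'x set \<Rightarrow> (complex ^ 'x::finite) set" where
  "complex_space S = {f. \<forall>u. u \<notin> S \<longrightarrow> f $ u = 0}"

abbreviation basis_vector :: "'x \<Rightarrow> complex ^ 'x::finite" where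
  "basis_vector u \<equiv> axis u 1"

definition linear_extension ::
  "'x set \<Rightarrow> ('x \<Rightarrow> complex ^ 'x::finite) \<Rightarrow> complex ^ 'x \<Rightarrow> complex ^ 'x" where
  "linear_extension S h = (\<lambda>f\<in>complex_space S. \<Sum>u\<in>S. (f $ u) *s h u)"

definition GL :: "(complex ^ 'x::finite) set \<Rightarrow> (complex ^ 'x \<Rightarrow> complex ^ 'x) monoid" where
  "GL W = BijGroup W \<lparr>carrier := {L \<in> carrier (BijGroup W).
     (\<forall>f\<in>W. \<forall>g\<in>W. L (f + g) = L f + L g) \<and> (\<forall>c. \<forall>f\<in>W. L (c *s f) = c *s L f)}\<rparr>"

definition m_map ::
  "('r::ring_1 \<Rightarrow> 'v::{ab_group_add,finite} \<Rightarrow> 'v) \<Rightarrow> ('n::finite \<Rightarrow> 'n) set \<Rightarrow> 'r \<Rightarrow>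
    complex ^ ('v ^ 'n) \<Rightarrow> complex ^ ('v ^ 'n)" where
  "m_map smul G r =
     linear_extension (theta_space smul G) (\<lambda>u. basis_vector (vec_smul smul r u))"

definition d_map ::
  "('r::ring_1 \<Rightarrow> 'v::{ab_group_add,finite} \<Rightarrow> 'v) \<Rightarrow> ('n::finite \<Rightarrow> 'n) set \<Rightarrow> ('p \<Rightarrow> 'v ^ 'n \<Rightarrow> qz) \<Rightarrow> 'p \<Rightarrow>
    complex ^ ('v ^ 'n) \<Rightarrow> complex ^ ('v ^ 'n)" where
  "d_map smul G \<rho>\<Phi> \<phi> =
     linear_extension (theta_space smul G) (\<lambda>u. qz_exp (\<rho>\<Phi> \<phi> u) *s basis_vector u)"

definition P_group ::
  "('r::ring_1 \<Rightarrow> 'v::{ab_group_add,finite} \<Rightarrow> 'v) \<Rightarrow> ('n::finite \<Rightarrow> 'n) set \<Rightarrow> ('p \<Rightarrow> 'v ^ 'n \<Rightarrow> qz) \<Rightarrow>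
    (complex ^ ('v ^ 'n) \<Rightarrow> complex ^ ('v ^ 'n)) set" where
  "P_group smul G \<rho>\<Phi> =
     generate (GL (complex_space (theta_space smul G)))
       (m_map smul G ` ring_units \<union> range (d_map smul G \<rho>\<Phi>))"

definition invariant_vectors :: "'a set \<Rightarrow> ('a \<Rightarrow> 'a) set \<Rightarrow> 'a set" where
  "invariant_vectors W P = {f \<in> W. \<forall>p\<in>P. p f = f}"

definition fwe :: "'x set \<Rightarrow> complex ^ 'x::finite" where
  "fwe D = (\<Sum>u\<in>D. basis_vector u)"

end

theory Submission
  imports Defs
begin

text \<open>A vector is fixed by the maps \<open>d\<^sub>\<phi>\<close> iff it is supported on the \<open>u\<close> at which every \<open>\<rho>\<^sub>\<Phi>(\<phi>)\<close> vanishes, and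
  by the maps \<open>m\<^sub>r\<close> iff it is constant on the orbits of \<open>R\<^sup>*\<close>. For such \<open>u\<close> the cyclic module \<open>Ru\<close> is an
  isotropic code, since \<open>\<rho>\<^sub>M(m)(ru \<otimes> su) = \<rho>\<^sub>\<Phi>({{m(r \<otimes> s)}})(u)\<close>, and it equals its image under \<open>\<theta>\<close>. In a module
  over a finite ring \<open>Ru = Rv\<close> implies \<open>v \<in> R\<^sup>*u\<close> (stable range one), so the value of an invariant vector at \<open>u\<close>
  depends only on \<open>Ru\<close>, and induction on \<open>|Ru|\<close> writes it as a combination of the enumerators of the
  modules \<open>Ru\<close>.\<close>

subsection \<open>Generators of cyclic modules over finite rings\<close>

text \<open>By pigeonhole two powers of x agree, so from \<open>x ^ i\<close> on the powers have
  period p. An exponent that is at least i and divisible by p gives an idempotent.\<close>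

lemma idempotent_power:
  fixes x :: "'a::{monoid_mult,finite}"
  obtains N where "N \<ge> 1" "x ^ N * x ^ N = x ^ N"
proof -
  have "\<not> inj (\<lambda>n::nat. x ^ n)"
    using finite_imageD[of "\<lambda>n::nat. x ^ n" UNIV] infinite_UNIV_nat by (auto simp: finite_subset[OF subset_UNIV])
  then obtain i j :: nat where ij: "i < j" "x ^ i = x ^ j"
    unfolding inj_def by (metis nat_neq_iff)
  define p where "p = j - i"
  have step: "x ^ (m + p) = x ^ m" if "m \<ge> i" for m
  proof -
    have "x ^ (m + p) = x ^ (m - i) * x ^ j"
      using that ij by (simp add: p_def flip: power_add)
    also have "\<dots> = x ^ m" using that by (simp add: ij(2)[symmetric] flip: power_add)
    finally show ?thesis .
  qed
  have per: "x ^ (m + n * p) = x ^ m" if "m \<ge> i" for m n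
  proof (induction n)
    case (Suc n)
    then show ?case using step[of "m + n * p"] that by (simp add: algebra_simps)
  qed simp
  have p: "p \<ge> 1" using ij by (simp add: p_def)
  \<comment> \<open>The factor \<open>Suc i\<close> instead of i keeps M positive when i =
    0.\<close>
  define M where "M = Suc i * p"
  have "Suc i * 1 \<le> Suc i * p" using p by (intro mult_le_mono) auto
  then have M: "M \<ge> i" "M \<ge> 1" by (simp_all add: M_def)
  have "x ^ M * x ^ M = x ^ M" using per[OF M(1), of "Suc i"] by (simp add: M_def flip: power_add)
  then show ?thesis using that M by blast
qed

text \<open>Left multiplication by x is undone by y, hence injective, hence surjective on a finite
  monoid. The resulting right inverse of x must be y.\<close>

lemma finite_left_inverse_imp_right_inverse:
  fixes x y :: "'a::{monoid_mult,finite}"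
  assumes "y * x = 1"
  shows "x * y = 1"
proof -
  have "inj (\<lambda>z. x * z)" by (rule inj_on_inverseI[of _ "\<lambda>z. y * z"]) (simp add: assms flip: mult.assoc)
  then obtain z where z: "x * z = 1" by (metis finite_UNIV_inj_surj subset_UNIV surjD finite)
  then have "z = y" using assms by (metis mult.assoc mult_1_left mult_1_right)
  with z show ?thesis by simp
qed

text \<open>Telescoping: consecutive terms \<open>x ^ j * y ^ j\<close> differ by
  \<open>x ^ j * (1 - x * y) * y ^ j\<close>.\<close>

lemma one_minus_power_mult_power:
  fixes x y :: "'a::ring_1"
  shows "1 - x ^ n * y ^ n = (\<Sum>j<n. x ^ j * (1 - x * y) * y ^ j)"
proof (induction n)
  case (Suc n)
  have "1 - x ^ Suc n * y ^ Suc n = (1 - x ^ n * y ^ n) + x ^ n * (1 - x * y) * y ^ n"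
    by (simp add: algebra_simps power_Suc2 del: power_Suc) (simp add: mult.assoc power_commutes)
  then show ?case using Suc by simp
qed simp

lemma one_minus_power_eq:
  fixes x :: "'a::ring_1"
  shows "1 - x ^ n = (\<Sum>j<n. x ^ j) * (1 - x)"
  by (induction n) (auto simp: algebra_simps power_commutes)

text \<open>If \<open>n = f A\<^sub>i B\<^sub>i f\<close> generates a nil left ideal of the corner ring \<open>fRf\<close>, then \<open>f - n\<close> is invertible
  there, which eliminates one summand.\<close>

lemma sum_nil_idempotent_eq_0:
  fixes f :: "'a::ring_1"
  assumes "finite J" "f * f = f" "f = (\<Sum>j\<in>J. A j * B j)"
    and "\<And>j u. j \<in> J \<Longrightarrow> \<exists>m. (f * u * A j * B j * f) ^ m = 0"
  shows "f = 0"
  using assms(1,3,4)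
proof (induction J arbitrary: A B rule: finite_induct)
  case (insert i J)
  define n where "n = f * A i * B i * f"
  from insert.prems(2)[of i 1] obtain m where m: "n ^ m = 0" by (auto simp: n_def)
  \<comment> \<open>n is nilpotent, so its geometric series is finite and inverts
    \<open>1 - n\<close>.\<close>
  define s where "s = (\<Sum>j<m. n ^ j)"
  have s: "s * (1 - n) = 1" using one_minus_power_eq[of n m] m by (simp add: s_def)
  have nf: "n * f = n" by (simp add: n_def mult.assoc assms(2))
  have "f = A i * B i + (\<Sum>j\<in>J. A j * B j)" using insert by simp
  then have "f * f * f = f * (A i * B i + (\<Sum>j\<in>J. A j * B j)) * f" by simp
  then have "f = n + f * (\<Sum>j\<in>J. A j * B j) * f"
    by (simp add: assms(2) n_def algebra_simps)
  then have fn: "f - n = f * (\<Sum>j\<in>J. A j * B j) * f" by (simp add: algebra_simps)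
  \<comment> \<open>By \<open>n * f = n\<close>, the product \<open>(1 - n) * f\<close> is
    \<open>f - n\<close>, which involves only the summands in J.\<close>
  have "f = f * (s * (1 - n)) * f" by (simp add: s assms(2))
  also have "\<dots> = f * s * (f - n)" using nf by (simp add: mult.assoc left_diff_distrib)
  also have "\<dots> = (\<Sum>j\<in>J. (f * s * f * A j) * (B j * f))"
    by (simp add: fn sum_distrib_left sum_distrib_right mult.assoc)
  finally have 1: "f = (\<Sum>j\<in>J. (f * s * f * A j) * (B j * f))" .
  \<comment> \<open>The nil hypothesis ranges over all u, so the factor gained to the left of
    \<open>A j\<close> is absorbed into u.\<close>
  have 2: "\<exists>m. (f * u * (f * s * f * A j) * (B j * f) * f) ^ m = 0" if "j \<in> J" for j u
    using insert.prems(2)[of j "u * f * s * f"] that by (simp add: mult.assoc assms(2))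
  show ?case by (rule insert.IH[OF 1 2])
qed simp

text \<open>Modulo the ideal generated by \<open>1 - xy\<close>, finiteness turns \<open>xy = 1\<close> into \<open>yx = 1\<close>.\<close>

lemma complement_in_two_sided_ideal:
  fixes x y :: "'a::{ring_1,finite}"
  assumes "x * y * x = x"
  obtains N :: nat and A B where "1 - y * x = (\<Sum>j<N. A j * (1 - x * y) * B j)"
proof -
  obtain N where N: "N \<ge> 1" "x ^ N * x ^ N = x ^ N" by (rule idempotent_power)
  define f where "f = 1 - y * x"
  have "x * f = 0" using assms by (simp add: f_def algebra_simps)
  then have xf: "x ^ N * f = 0" using N(1) by (cases N) (simp_all add: power_Suc2 mult.assoc del: power_Suc)
  have "f = (1 - x ^ N) * f" using xf by (simp add: algebra_simps)
  \<comment> \<open>Since \<open>x ^ N\<close> is idempotent,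
    \<open>(1 - x ^ N) * x ^ N = 0\<close>, and the factor \<open>1 - x ^ N * y ^ N\<close> may be
    inserted. Telescoping it puts \<open>1 - x * y\<close> into every summand.\<close>
  also have "1 - x ^ N = (1 - x ^ N) * (1 - x ^ N * y ^ N)"
    using N(2) by (simp add: algebra_simps) (simp flip: mult.assoc)
  also have "\<dots> * f = (\<Sum>j<N. ((1 - x ^ N) * x ^ j) * (1 - x * y) * (y ^ j * f))"
    by (simp only: one_minus_power_mult_power sum_distrib_left sum_distrib_right mult.assoc)
  finally show ?thesis unfolding f_def by (rule that)
qed

text \<open>The nonzero idempotent \<open>f = 1 - y * x\<close> lies in the two-sided ideal of
  \<open>k = 1 - x * y\<close>. By \<open>sum_nil_idempotent_eq_0\<close> some element of fRkRf is
  not nilpotent. A power of it is a nonzero idempotent g that factors through k, and g splits into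
  mutually inverse p in kRf and q in fRk.\<close>

lemma equivalent_subidempotents:
  fixes x y :: "'a::{ring_1,finite}"
  assumes xyx: "x * y * x = x" and ne: "y * x \<noteq> 1"
  obtains p q where "p * q * p = p" "q * p * q = q" "q * p \<noteq> 0"
    "(1 - x * y) * p = p" "p * (1 - y * x) = p" "(1 - y * x) * q = q" "q * (1 - x * y) = q"
proof -
  define f k where "f = 1 - y * x" and "k = 1 - x * y"
  have ff: "f * f = f" and kk: "k * k = k"
    using xyx by (simp_all add: f_def k_def algebra_simps) (simp_all flip: mult.assoc)
  obtain N :: nat and A B where "f = (\<Sum>j<N. A j * k * B j)"
    using complement_in_two_sided_ideal[OF xyx] unfolding f_def k_def by blast
  also have "\<dots> = (\<Sum>j<N. (A j * k) * (k * B j))" by (metis kk mult.assoc)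
  finally have fs: "f = (\<Sum>j<N. (A j * k) * (k * B j))" .
  have "f \<noteq> 0" using ne by (simp add: f_def)
  then obtain j u where nil: "\<And>m. (f * u * (A j * k) * (k * B j) * f) ^ m \<noteq> 0"
    using sum_nil_idempotent_eq_0[OF _ ff fs] by blast
  define p0 q0 w where "p0 = k * B j * f" and "q0 = f * u * A j * k" and "w = q0 * p0"
  have w: "w = f * u * (A j * k) * (k * B j) * f" by (simp add: w_def p0_def q0_def mult.assoc)
  obtain M where M: "M \<ge> 1" "w ^ M * w ^ M = w ^ M" by (rule idempotent_power)
  define g where "g = w ^ M"
  have g0: "g \<noteq> 0" using nil[of M] by (simp add: g_def w)
  have gg: "g * g = g" by (simp add: g_def M)
  \<comment> \<open>The power \<open>w ^ (M - 1)\<close> supplies what \<open>q0 * p0 = w\<close>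
    lacks to reach \<open>g = w ^ M\<close>, so that \<open>q * p = g\<close>.\<close>
  define p q where "p = p0 * g" and "q = g * w ^ (M - 1) * q0"
  have "w ^ (M - 1) * w = g" using M(1) by (simp add: g_def flip: power_Suc2)
  then have qp: "q * p = g" by (simp add: p_def q_def w_def[symmetric] mult.assoc gg)
    (metis gg mult.assoc w_def)
  have p0: "k * p0 = p0" "p0 * f = p0" "q0 * k = q0" "f * q0 = q0"
    by (simp_all add: p0_def q0_def mult.assoc ff kk) (simp_all flip: mult.assoc add: ff kk)
  have "f * w = w" "w * f = w" by (simp_all add: w_def mult.assoc p0) (simp flip: mult.assoc add: p0)
  then have fg: "f * g = g" "g * f = g"
    using M(1) by (cases M; simp add: g_def flip: mult.assoc; fail)
      (use M(1) \<open>w * f = w\<close> in \<open>cases M; simp add: g_def power_Suc2 mult.assoc del: power_Suc\<close>)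
  show ?thesis
  proof (rule that[of p q])
    show "p * q * p = p" by (simp add: mult.assoc qp) (simp add: p_def mult.assoc gg)
    show "q * p * q = q" by (simp add: qp) (simp add: q_def gg flip: mult.assoc)
    show "q * p \<noteq> 0" using g0 qp by simp
  qed (simp_all add: p_def q_def mult.assoc p0 fg flip: f_def k_def,
      simp_all flip: mult.assoc add: p0 fg)
qed

definition left_ideal :: "'a::ring_1 set \<Rightarrow> bool" where
  "left_ideal L \<longleftrightarrow> 0 \<in> L \<and> (\<forall>a\<in>L. \<forall>b\<in>L. a + b \<in> L) \<and> (\<forall>r. \<forall>a\<in>L. r * a \<in> L)"

text \<open>Among the pairs of mutually inverse von Neumann regular elements \<open>x \<in> a + L\<close>, \<open>y\<close> with \<open>1 - yx \<in> L\<close>,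
  one with \<open>Ryx\<close> largest has \<open>yx = 1\<close>: otherwise equivalent idempotents below \<open>1 - yx\<close> and \<open>1 - xy\<close> enlarge it.\<close>

lemma left_ideal_unit_in_coset:
  fixes a b :: "'a::{ring_1,finite}"
  assumes L: "left_ideal L" and ba: "1 - b * a \<in> L"
  obtains c where "c \<in> ring_units" "c - a \<in> L"
proof -
  have Lm: "r * l \<in> L" if "l \<in> L" for r l using L that by (auto simp: left_ideal_def)
  have La: "l + l' \<in> L" if "l \<in> L" "l' \<in> L" for l l' using L that by (auto simp: left_ideal_def)
  define Q where "Q = {(x, y). x * y * x = x \<and> y * x * y = y \<and> 1 - y * x \<in> L \<and> x - a \<in> L}"
  define \<mu> where "\<mu> = (\<lambda>(x::'a, y). card (range (\<lambda>r. r * (y * x))))"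
  have "Q \<noteq> {}"
  proof -
    define s where "s = b * a"
    obtain N where N: "N \<ge> 1" "s ^ N * s ^ N = s ^ N" by (rule idempotent_power)
    define e where "e = s ^ N"
    have ee: "e * e = e" by (simp add: e_def N)
    have se: "s ^ (N - 1) * s = e" using N(1) by (simp add: e_def flip: power_Suc2)
    have 1: "1 - e \<in> L" unfolding e_def one_minus_power_eq by (rule Lm) (simp add: s_def ba)
    \<comment> \<open>As \<open>s = b * a\<close> is 1 modulo L, so is its idempotent power e; hence
      \<open>a * e\<close> stays in the coset of a, and y is chosen to make
      \<open>y * x = e\<close>.\<close>
    define x y where "x = a * e" and "y = e * s ^ (N - 1) * b"
    have yx: "y * x = e"
    proof -
      have "y * x = e * (s ^ (N - 1) * s) * e" by (simp add: x_def y_def s_def mult.assoc)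
      then show ?thesis by (simp only: se ee)
    qed
    have "x - a = (- a) * (1 - e)" by (simp add: x_def algebra_simps)
    then have 2: "x - a \<in> L" using Lm[OF 1, of "- a"] by simp
    have 3: "x * y * x = x" by (simp add: mult.assoc yx) (simp add: x_def mult.assoc ee)
    have 4: "y * x * y = y" by (simp add: yx) (simp add: y_def ee flip: mult.assoc)
    have "(x, y) \<in> Q" using 1 2 3 4 by (simp add: Q_def yx)
    then show ?thesis by blast
  qed
  moreover have "\<forall>z. z \<in> Q \<longrightarrow> \<mu> z < Suc CARD('a)"
    by (auto simp: \<mu>_def less_Suc_eq_le intro: card_mono)
  ultimately obtain z where "z \<in> Q" "\<forall>z'. z' \<in> Q \<longrightarrow> \<mu> z' \<le> \<mu> z"
    using ex_has_greatest_nat[of "\<lambda>z. z \<in> Q" _ \<mu> "Suc CARD('a)"] by (metis ex_in_conv)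
  then obtain x y where xy: "(x, y) \<in> Q" and max: "\<And>x' y'. (x', y') \<in> Q \<Longrightarrow> \<mu> (x', y') \<le> \<mu> (x, y)"
    by (metis surj_pair)
  from xy have xyx: "x * y * x = x" and yxy: "y * x * y = y" and fL: "1 - y * x \<in> L" and xL: "x - a \<in> L"
    by (auto simp: Q_def)
  have "y * x = 1"
  proof (rule ccontr)
    assume ne: "y * x \<noteq> 1"
    obtain p q where pq: "p * q * p = p" "q * p * q = q" "q * p \<noteq> 0"
      "(1 - x * y) * p = p" "p * (1 - y * x) = p" "(1 - y * x) * q = q" "q * (1 - x * y) = q"
      using equivalent_subidempotents[OF xyx ne] by blast
    \<comment> \<open>p is a left multiple of \<open>1 - y * x\<close>, so adding it to x does not
      leave the coset \<open>a + L\<close>.\<close>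
    have pL: "p \<in> L" using Lm[OF fL, of p] pq(5) by simp
    \<comment> \<open>The complementary idempotents kill all mixed products, so both pairs can be
      added: \<open>(y + q) * (x + p) = y * x + q * p\<close>.\<close>
    have z: "x * q = 0" "q * x = 0" "y * p = 0" "p * y = 0"
    proof -
      have "x * ((1 - y * x) * q) = (x - x * y * x) * q" by (simp add: algebra_simps)
      then show "x * q = 0" by (simp add: pq xyx)
      have "(q * (1 - x * y)) * x = q * (x - x * y * x)" by (simp add: algebra_simps)
      then show "q * x = 0" by (simp add: pq xyx)
      have "y * ((1 - x * y) * p) = (y - y * x * y) * p" by (simp add: algebra_simps)
      then show "y * p = 0" by (simp add: pq yxy)
      have "(p * (1 - y * x)) * y = p * (y - y * x * y)" by (simp add: algebra_simps)
      then show "p * y = 0" by (simp add: pq yxy)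
    qed
    have z': "x * (q * r) = 0" "q * (x * r) = 0" "y * (p * r) = 0" "p * (y * r) = 0" for r
      using z by (simp_all flip: mult.assoc)
    have e': "(y + q) * (x + p) = y * x + q * p" by (simp add: algebra_simps z)
    have m: "x * (y * x) = x" "y * (x * y) = y" "p * (q * p) = p" "q * (p * q) = q"
      using xyx yxy pq by (simp_all add: mult.assoc)
    \<comment> \<open>Rewritten as a left multiple of \<open>1 - y * x\<close>, the new defect stays
      in the left ideal L.\<close>
    have "1 - (y * x + q * p) = (1 - y * x) - q * (p * (1 - y * x))" by (simp add: pq)
    also have "\<dots> = (1 - q * p) * (1 - y * x)" by (simp add: algebra_simps)
    finally have "1 - (y * x + q * p) \<in> L" using Lm[OF fL] by simp
    moreover have "x + p - a \<in> L" using La[OF xL pL] by (simp add: algebra_simps)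
    ultimately have "(x + p, y + q) \<in> Q"
      by (simp add: Q_def e' mult.assoc) (simp add: algebra_simps z z' m)
    then have "\<mu> (x + p, y + q) \<le> \<mu> (x, y)" by (rule max)
    moreover have "range (\<lambda>r. r * (y * x)) \<subset> range (\<lambda>r. r * (y * x + q * p))"
    proof
      \<comment> \<open>The new idempotent is a right identity on Ryx, which gives the inclusion. It
        is strict: if \<open>q * p\<close> were in Ryx, then
        \<open>q * p = q * p * (y * x) = 0\<close>.\<close>
      have "r * (y * x) = (r * (y * x)) * (y * x + q * p)" for r
        by (simp add: algebra_simps m z z')
      then show "range (\<lambda>r. r * (y * x)) \<subseteq> range (\<lambda>r. r * (y * x + q * p))" by blast
      have "q * p = (q * p) * (y * x + q * p)" by (simp add: algebra_simps m z z')
      then have "q * p \<in> range (\<lambda>r. r * (y * x + q * p))" by blast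
      moreover have "q * p \<notin> range (\<lambda>r. r * (y * x))"
      proof
        assume "q * p \<in> range (\<lambda>r. r * (y * x))"
        then obtain r where r: "q * p = r * (y * x)" by blast
        then have "q * p = q * p * (y * x)" by (simp add: mult.assoc m)
        then show False using pq(3) by (simp add: mult.assoc z')
      qed
      ultimately show "range (\<lambda>r. r * (y * x)) \<noteq> range (\<lambda>r. r * (y * x + q * p))" by blast
    qed
    then have "\<mu> (x, y) < \<mu> (x + p, y + q)" by (simp add: \<mu>_def e' psubset_card_mono)
    ultimately show False by simp
  qed
  then have "x \<in> ring_units" using finite_left_inverse_imp_right_inverse[of y x] by (auto simp: ring_units_def)
  then show ?thesis using that xL by blast
qed

section \<open>Generators of a cyclic module\<close>

context left_module
begin

lemma smul_zero_left [simp]: "smul 0 x = 0"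
  using smul_add_left[of 0 0 x] by simp

lemma smul_zero_right [simp]: "smul r 0 = 0"
  using smul_add_right[of r 0 0] by simp

lemma smul_minus_left: "smul (- r) x = - smul r x"
  using smul_add_left[of r "- r" x] by (simp add: eq_neg_iff_add_eq_0 add.commute)

lemma smul_diff_left: "smul (r - s) x = smul r x - smul s x"
  using smul_add_left[of r "- s" x] by (simp add: smul_minus_left)

end

text \<open>If v = au and u = bv, then \<open>1 - b * a\<close> lies in the annihilator of u, a left
  ideal. The coset of a modulo this ideal contains a unit c, and cu = au = v.\<close>

lemma cyclic_eq_imp_unit_multiple:
  fixes smul :: "'r::{ring_1,finite} \<Rightarrow> 'v::ab_group_add \<Rightarrow> 'v"
  assumes "left_module smul" and eq: "range (\<lambda>r. smul r u) = range (\<lambda>r. smul r v)"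
  obtains c where "c \<in> ring_units" "smul c u = v"
proof -
  interpret left_module smul by fact
  have "smul 1 v \<in> range (\<lambda>r. smul r u)" and "smul 1 u \<in> range (\<lambda>r. smul r v)"
    using eq by blast+
  then obtain a b where a: "v = smul a u" and b: "u = smul b v" unfolding smul_one by blast
  have "left_ideal {r. smul r u = 0}"
    by (auto simp: left_ideal_def smul_add_left smul_smul[symmetric])
  moreover have "1 - b * a \<in> {r. smul r u = 0}"
    by (simp add: smul_diff_left smul_one smul_smul[symmetric] flip: a b)
  ultimately obtain c where "c \<in> ring_units" "c - a \<in> {r. smul r u = 0}"
    by (rule left_ideal_unit_in_coset)
  then have "smul c u = v" by (simp add: smul_diff_left flip: a)
  then show ?thesis using that \<open>c \<in> ring_units\<close> by blast
qed

section \<open>Enumerators of cyclic modules\<close>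

lemma fwe_nth: "fwe D $ u = (if u \<in> D then 1 else 0)"
proof -
  have "fwe D $ u = (\<Sum>v\<in>D. if v = u then 1 else 0)"
    by (simp add: fwe_def axis_def)
  then show ?thesis by simp
qed

text \<open>Induction on a bound k beyond which f vanishes, measured by |Ru|. The values at |Ru| = k
  are removed by subtracting enumerators of modules of size k; these are supported on u with |Ru| at
  most k, so no larger values reappear.\<close>

lemma span_fwe_cyclic:
  fixes smul :: "'r::{ring_1,finite} \<Rightarrow> 'x::{ab_group_add,finite} \<Rightarrow> 'x" and f :: "complex ^ 'x::{ab_group_add,finite}"
  assumes "left_module smul"
    and S: "\<And>u r. u \<in> S \<Longrightarrow> smul r u \<in> S"
    and supp: "\<And>u. u \<notin> S \<Longrightarrow> f $ u = 0"
    and inv: "\<And>c u. c \<in> ring_units \<Longrightarrow> f $ smul c u = f $ u"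
  shows "f \<in> vec.span ((\<lambda>u. fwe (range (\<lambda>r. smul r u))) ` S)"
proof -
  interpret left_module smul by fact
  define R where "R = (\<lambda>u. range (\<lambda>r. smul r u))"
  have R_refl: "u \<in> R u" for u unfolding R_def using smul_one by (metis rangeI)
  have R_sub: "R v \<subseteq> R u" if "v \<in> R u" for u v using that by (auto simp: R_def smul_smul)
  have R_iff: "v \<in> R u \<longleftrightarrow> R v \<subseteq> R u" for u v using R_refl R_sub by blast
  have RS: "R u \<subseteq> S" if "u \<in> S" for u using S that by (auto simp: R_def)
  have "f \<in> vec.span ((\<lambda>u. fwe (R u)) ` S)"
    if "\<And>u. u \<notin> S \<Longrightarrow> f $ u = 0" "\<And>u v. R u = R v \<Longrightarrow> f $ u = f $ v"
      "\<And>u. card (R u) \<ge> k \<Longrightarrow> f $ u = 0" for f k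
    using that
  proof (induction k arbitrary: f)
    case 0
    have "f = 0" using 0(3) by (simp add: vec_eq_iff)
    then show ?case by (simp add: vec.span_zero)
  next
    case (Suc k)
    \<comment> \<open>The sum runs over elements v, not modules, so each module occurs once for each
      of its generators; the denominator counts these.\<close>
    define g where "g = (\<Sum>v\<in>{v\<in>S. card (R v) = k}. (f $ v / of_nat (card {w. R w = R v})) *s fwe (R v))"
    have g_nth: "g $ u = (\<Sum>v | v \<in> S \<and> card (R v) = k \<and> R u \<subseteq> R v. f $ v / of_nat (card {w. R w = R v}))" for u
      unfolding g_def by (simp add: fwe_nth if_distrib[of "\<lambda>x. _ * x"] R_iff cong: if_cong)
        (simp add: sum.If_cases Int_def conj_assoc)
    have g: "g \<in> vec.span ((\<lambda>u. fwe (R u)) ` S)"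
      unfolding g_def by (intro vec.span_sum vec.span_scale vec.span_base) auto
    have "f - g \<in> vec.span ((\<lambda>u. fwe (R u)) ` S)"
    proof (rule Suc.IH)
      fix u assume u: "u \<notin> S"
      then have "{v \<in> S. card (R v) = k \<and> R u \<subseteq> R v} = {}" using R_refl[of u] RS by blast
      then show "(f - g) $ u = 0" by (simp only: vector_minus_component g_nth) (simp add: Suc.prems(1)[OF u])
    next
      fix u v assume "R u = R v"
      then show "(f - g) $ u = (f - g) $ v" using Suc.prems(2)[of u v] by (simp add: g_nth)
    next
      fix u assume k: "k \<le> card (R u)"
      have le: "card (R u) \<le> card (R v)" if "R u \<subseteq> R v" for v by (rule card_mono) (use that in auto)
      have eq: "R u = R v" if "R u \<subseteq> R v" "card (R v) = k" for v
        by (rule card_seteq) (use that k in auto)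
      show "(f - g) $ u = 0"
      proof (cases "card (R u) = k \<and> u \<in> S")
        case True
        \<comment> \<open>Equal cardinality turns inclusion into equality, and all generators of Ru
          lie in S because Ru does.\<close>
        have "{v \<in> S. card (R v) = k \<and> R u \<subseteq> R v} = {w. R w = R u}"
          using True eq RS[of u] R_refl by auto
        then have "g $ u = (\<Sum>v | R v = R u. f $ u / of_nat (card {w. R w = R u}))"
          unfolding g_nth
        proof (rule sum.cong)
          fix v assume "v \<in> {v. R v = R u}"
          then have "R v = R u" by simp
          with Suc.prems(2)[OF this]
          show "f $ v / of_nat (card {w. R w = R v}) = f $ u / of_nat (card {w. R w = R u})"
            by simp
        qed
        also have "\<dots> = f $ u"
        proof -
          have "card {w. R w = R u} \<noteq> 0" by (simp add: card_eq_0_iff) blast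
          then show ?thesis by simp
        qed
        finally show ?thesis by simp
      next
        case False
        \<comment> \<open>A contributing v would force Ru = Rv, hence |Ru| = k and u in S.\<close>
        have "{v \<in> S. card (R v) = k \<and> R u \<subseteq> R v} = {}"
        proof (rule ccontr)
          assume "\<not> ?thesis"
          then obtain v where v: "v \<in> S" "card (R v) = k" "R u \<subseteq> R v" by blast
          have "R u = R v" by (rule eq[OF v(3,2)])
          then show False using False v RS[OF v(1)] R_refl[of u] by auto
        qed
        moreover have "f $ u = 0" using Suc.prems(1,3)[of u] False k by auto
        ultimately show ?thesis by (simp only: vector_minus_component g_nth) simp
      qed
    qed
    then show ?case using vec.span_add[OF _ g] by fastforce
  qed
  moreover have "f $ u = f $ v" if "R u = R v" for u v
    using cyclic_eq_imp_unit_multiple[OF assms(1) that[unfolded R_def]] inv by metis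
  \<comment> \<open>The induction starts at \<open>Suc CARD('x)\<close>, where the vanishing
    condition is vacuous.\<close>
  moreover have "card (R u) \<le> CARD('x)" for u by (rule card_mono) auto
  then have "f $ u = 0" if "card (R u) \<ge> Suc CARD('x)" for u using that by (meson not_less_eq_eq)
  ultimately show ?thesis using supp unfolding R_def by blast
qed

subsection \<open>Linear maps on \<open>\<complex>[S]\<close>\<close>

text \<open>Faithfulness of this character of Q/Z: fixing \<open>e_u\<close> under a diagonal map
  detects the vanishing of the form at u.\<close>

lemma qz_exp_eq_1_iff: "qz_exp q = 1 \<longleftrightarrow> q = 0"
proof (transfer)
  fix q :: rat
  have R: "of_rat q = complex_of_real (of_rat q)" by (cases q) (simp add: of_rat_rat)
  have "(exp (2 * complex_of_real pi * \<i> * of_rat q) = 1) \<longleftrightarrow> (\<exists>n::int. 2 * pi * of_rat q = of_int (2 * n) * pi)"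
    by (simp add: R exp_eq_1)
  also have "\<dots> \<longleftrightarrow> (\<exists>n::int. of_rat q = (of_rat (of_int n) :: real))" by (simp add: mult.commute)
  also have "\<dots> \<longleftrightarrow> q - 0 \<in> \<int>" by (simp only: of_rat_eq_iff) (auto simp: Ints_def)
  finally show "(exp (2 * complex_of_real pi * \<i> * of_rat q) = 1) \<longleftrightarrow> q - 0 \<in> \<int>" .
qed

lemma qz_exp_add: "qz_exp (p + q) = qz_exp p * qz_exp q"
  by transfer (simp add: of_rat_add distrib_left exp_add)

lemma carrier_GL_iff:
  "L \<in> carrier (GL W) \<longleftrightarrow> L \<in> Bij W \<and> (\<forall>f\<in>W. \<forall>g\<in>W. L (f + g) = L f + L g)
     \<and> (\<forall>c. \<forall>f\<in>W. L (c *s f) = c *s L f)"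
  by (simp add: GL_def BijGroup_def)

text \<open>The inverse of a linear bijection is linear. This makes \<open>GL W\<close> a group,
  which is needed to handle inverses in \<open>generate (GL W)\<close>.\<close>

lemma subgroup_linear_bijections:
  fixes W :: "(complex ^ 'x::finite) set"
  assumes W: "vec.subspace W"
  shows "subgroup (carrier (GL W)) (BijGroup W)"
proof -
  interpret B: group "BijGroup W" by (rule group_BijGroup)
  note add = vec.subspace_add[OF W] and scale = vec.subspace_scale[OF W]
  have car: "carrier (BijGroup W) = Bij W" by (simp add: BijGroup_def)
  have maps: "L u \<in> W" if "L \<in> Bij W" "u \<in> W" for L u
    using Bij_imp_funcset[OF that(1)] that(2) by blast
  show ?thesis
  proof (rule B.subgroupI)
    show "carrier (GL W) \<subseteq> carrier (BijGroup W)" by (auto simp: carrier_GL_iff car)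
    have "(\<lambda>x\<in>W. x) \<in> carrier (GL W)"
      by (simp add: carrier_GL_iff id_Bij add scale)
    then show "carrier (GL W) \<noteq> {}" by blast
  next
    fix L assume L_GL: "L \<in> carrier (GL W)"
    define K where "K = inv\<^bsub>BijGroup W\<^esub> L"
    have L: "L \<in> Bij W" using L_GL by (simp add: carrier_GL_iff)
    then have K: "K \<in> Bij W" using B.inv_closed[of L] by (simp only: K_def car)
    have bij: "bij_betw L W W" using L by (simp add: Bij_def)
    have K_eq: "K v = inv_into W L v" if "v \<in> W" for v
      using that by (simp add: K_def inv_BijGroup[OF L])
    have LK: "L (K v) = v" if "v \<in> W" for v
      using bij_betw_inv_into_right[OF bij that] K_eq[OF that] by simp
    have KL: "K (L v) = v" if "v \<in> W" for v
      using bij_betw_inv_into_left[OF bij that] K_eq[OF maps[OF L that]] by simp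
    have "K (f + g) = K f + K g" if "f \<in> W" "g \<in> W" for f g
    proof -
      have "L (K f + K g) = f + g" using L_GL that by (simp add: carrier_GL_iff LK maps[OF K])
      then show ?thesis using KL[of "K f + K g"] that by (simp add: maps[OF K] add)
    qed
    moreover have "K (c *s f) = c *s K f" if "f \<in> W" for c f
    proof -
      have "L (c *s K f) = c *s f" using L_GL that by (simp add: carrier_GL_iff LK maps[OF K])
      then show ?thesis using KL[of "c *s K f"] that by (simp add: maps[OF K] scale)
    qed
    ultimately show "inv\<^bsub>BijGroup W\<^esub> L \<in> carrier (GL W)"
      using K by (simp add: carrier_GL_iff flip: K_def)
  next
    fix L K assume "L \<in> carrier (GL W)" "K \<in> carrier (GL W)"
    moreover from this have "L \<otimes>\<^bsub>BijGroup W\<^esub> K = compose W L K"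
      by (simp add: carrier_GL_iff BijGroup_def)
    ultimately show "L \<otimes>\<^bsub>BijGroup W\<^esub> K \<in> carrier (GL W)"
      by (simp add: carrier_GL_iff compose_Bij compose_eq add scale maps)
  qed
qed

text \<open>The stabilizer of f is a subgroup, so it contains the generated group once it contains
  the generators.\<close>

lemma generate_GL_fixes:
  fixes W :: "(complex ^ 'x::finite) set"
  assumes W: "vec.subspace W" and H: "H \<subseteq> carrier (GL W)" and f: "f \<in> W"
    and fixed: "\<And>h. h \<in> H \<Longrightarrow> h f = f" and p: "p \<in> generate (GL W) H"
  shows "p f = f"
proof -
  have GL: "GL W = BijGroup W \<lparr>carrier := carrier (GL W)\<rparr>" by (simp add: GL_def)
  interpret GL: group "GL W"
    by (subst GL) (rule subgroup.subgroup_is_group[OF subgroup_linear_bijections[OF W] group_BijGroup])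
  have mult: "(L \<otimes>\<^bsub>GL W\<^esub> K) f = L (K f)" if "L \<in> carrier (GL W)" "K \<in> carrier (GL W)" for L K
    using that f by (simp add: GL_def BijGroup_def compose_eq)
  have one: "\<one>\<^bsub>GL W\<^esub> f = f" using f by (simp add: GL_def BijGroup_def)
  show ?thesis using p
  proof (induction rule: generate.induct)
    case (inv h)
    then have h: "h \<in> carrier (GL W)" using H by blast
    have "(inv\<^bsub>GL W\<^esub> h) (h f) = f" using mult[OF GL.inv_closed[OF h] h] one by (simp add: h)
    then show ?case using fixed[OF inv] by simp
  next
    case (eng h1 h2)
    then show ?case using mult GL.generate_in_carrier[OF H] by simp
  qed (simp_all add: one fixed)
qed

lemma subspace_complex_space: "vec.subspace (complex_space S)"
  by (simp add: vec.subspace_def complex_space_def)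

lemma linear_extension_nth:
  assumes "f \<in> complex_space S"
  shows "linear_extension S h f $ w = (\<Sum>u\<in>S. f $ u * h u $ w)"
  using assms by (simp add: linear_extension_def)

text \<open>Linearity comes from the defining sum; bijectivity is certified by an inverse that is
  again a linear extension.\<close>

lemma linear_extension_in_GL:
  assumes "\<And>f. f \<in> complex_space S \<Longrightarrow> linear_extension S h f \<in> complex_space S"
    and "\<And>f. f \<in> complex_space S \<Longrightarrow> linear_extension S h' f \<in> complex_space S"
    and "\<And>f. f \<in> complex_space S \<Longrightarrow> linear_extension S h' (linear_extension S h f) = f"
    and "\<And>f. f \<in> complex_space S \<Longrightarrow> linear_extension S h (linear_extension S h' f) = f"
  shows "linear_extension S h \<in> carrier (GL (complex_space S))"
proof -
  have "bij_betw (linear_extension S h) (complex_space S) (complex_space S)"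
    by (rule bij_betw_byWitness[of _ "linear_extension S h'"]) (use assms in auto)
  then have "linear_extension S h \<in> Bij (complex_space S)"
    by (simp add: Bij_def linear_extension_def)
  moreover have "linear_extension S h (f + g) = linear_extension S h f + linear_extension S h g"
    if "f \<in> complex_space S" "g \<in> complex_space S" for f g
    using that vec.subspace_add[OF subspace_complex_space that]
    by (simp add: vec_eq_iff linear_extension_nth sum.distrib algebra_simps)
  moreover have "linear_extension S h (c *s f) = c *s linear_extension S h f"
    if "f \<in> complex_space S" for c f
    using that vec.subspace_scale[OF subspace_complex_space that, of c]
    by (simp add: vec_eq_iff linear_extension_nth sum_distrib_left mult.assoc)
  ultimately show ?thesis by (simp add: GL_def BijGroup_def)
qed

subsection \<open>Codes and their invariants\<close>

lemma ring_inverse_mult: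
  assumes "r \<in> ring_units"
  shows "r * ring_inverse r = 1" "ring_inverse r * r = 1"
proof -
  obtain s where s: "r * s = 1" "s * r = 1" using assms by (auto simp: ring_units_def)
  have "ring_inverse r = s"
    unfolding ring_inverse_def
  proof (rule the_equality)
    fix s' assume s': "r * s' = 1 \<and> s' * r = 1"
    have "s' = s' * (r * s)" by (simp add: s)
    also have "\<dots> = s" using s' by (simp flip: mult.assoc)
    finally show "s' = s" .
  qed (use s in blast)
  then show "r * ring_inverse r = 1" "ring_inverse r * r = 1" using s by auto
qed

text \<open>Integer multiples of 1 are central, hence so are their inverses. Over a noncommutative R
  this makes theta commute with scalars.\<close>

lemma ring_inverse_of_nat_commute:
  fixes r :: "'r::ring_1"
  assumes "(of_nat n :: 'r) \<in> ring_units"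
  shows "ring_inverse (of_nat n) * r = r * ring_inverse (of_nat n)"
proof -
  let ?c = "ring_inverse (of_nat n)"
  note c = ring_inverse_mult[OF assms]
  have "?c * r = ?c * (r * of_nat n) * ?c" by (simp add: mult.assoc c)
  also have "r * of_nat n = of_nat n * r" by (rule mult_of_nat_commute[symmetric])
  also have "?c * (of_nat n * r) * ?c = r * ?c" by (simp add: c flip: mult.assoc)
  finally show ?thesis .
qed

lemma left_module_vec_smul:
  assumes "left_module smul"
  shows "left_module (vec_smul smul :: 'r::ring_1 \<Rightarrow> 'v::ab_group_add ^ 'n \<Rightarrow> 'v ^ 'n)"
proof -
  interpret left_module smul by fact
  show ?thesis
    by unfold_locales (simp_all add: vec_smul_def vec_eq_iff smul_add_right smul_add_left smul_smul smul_one)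
qed

lemma (in left_module) smul_sum_right: "smul r (\<Sum>i\<in>I. h i) = (\<Sum>i\<in>I. smul r (h i))"
  by (induction I rule: infinite_finite_induct) (simp_all add: smul_add_right)

lemma (in left_module) smul_sum_left: "smul (\<Sum>i\<in>I. a i) x = (\<Sum>i\<in>I. smul (a i) x)"
  by (induction I rule: infinite_finite_induct) (simp_all add: smul_add_left)

section \<open>The action of G on V^n, the projection theta and cyclic codes\<close>

locale permutation_module = left_module smul
  for smul :: "'r::{ring_1,finite} \<Rightarrow> 'v::{ab_group_add,finite} \<Rightarrow> 'v" +
  fixes G :: "('n::finite \<Rightarrow> 'n) set"
  assumes subgroup_G: "subgroup G (BijGroup UNIV)"
    and card_G_unit: "(of_nat (card G) :: 'r) \<in> ring_units"
begin

sublocale vecs: left_module "vec_smul smul :: 'r \<Rightarrow> 'v ^ 'n \<Rightarrow> 'v ^ 'n"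
  by (rule left_module_vec_smul) (rule left_module_axioms)

abbreviation scale :: "'r \<Rightarrow> 'v ^ 'n \<Rightarrow> 'v ^ 'n" where
  "scale \<equiv> vec_smul smul"

abbreviation proj :: "'v ^ 'n \<Rightarrow> 'v ^ 'n" where
  "proj \<equiv> group_ring_act smul G (theta G)"

abbreviation T :: "('v ^ 'n) set" where
  "T \<equiv> theta_space smul G"

lemma G_bij: "g \<in> G \<Longrightarrow> bij g"
  using subgroup.subset[OF subgroup_G] by (auto simp: BijGroup_def Bij_def)

lemma id_in_G: "id \<in> G"
  using subgroup.one_closed[OF subgroup_G] by (simp add: BijGroup_def id_def restrict_def)

lemma comp_in_G: "g \<in> G \<Longrightarrow> h \<in> G \<Longrightarrow> g \<circ> h \<in> G"
  using subgroup.m_closed[OF subgroup_G, of g h] subgroup.subset[OF subgroup_G]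
  by (auto simp: BijGroup_def compose_def comp_def restrict_def subset_iff)

lemma perm_act_comp: "g \<in> G \<Longrightarrow> h \<in> G \<Longrightarrow> perm_act g (perm_act h v) = perm_act (g \<circ> h) v"
  using G_bij[of g] G_bij[of h] by (simp add: perm_act_def vec_eq_iff o_inv_distrib)

lemma perm_act_id: "perm_act id v = v"
  by (simp add: perm_act_def vec_eq_iff)

lemma perm_act_scale: "perm_act g (scale r v) = scale r (perm_act g v)"
  by (simp add: perm_act_def vec_smul_def vec_eq_iff)

lemma perm_act_sum: "perm_act g (\<Sum>i\<in>I. h i :: 'v ^ 'n) = (\<Sum>i\<in>I. perm_act g (h i))"
  by (simp add: perm_act_def vec_eq_iff)

lemma proj_eq: "proj v = (\<Sum>g\<in>G. scale (ring_inverse (of_nat (card G))) (perm_act g v))"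
  by (simp add: group_ring_act_def theta_def)

text \<open>Left translation by h permutes the finite set G, so it only reorders the averaging
  sum.\<close>

lemma perm_act_proj:
  assumes "h \<in> G"
  shows "perm_act h (proj v) = proj v"
proof -
  have "inj_on ((\<circ>) h) G" 
    using fun.inj_map[OF bij_is_inj[OF G_bij[OF assms]]] by (rule inj_on_subset) simp
  moreover have "(\<circ>) h ` G \<subseteq> G" using comp_in_G[OF assms] by auto
  ultimately have "bij_betw ((\<circ>) h) G G" by (simp add: bij_betw_def endo_inj_surj)
  then have "(\<Sum>g\<in>G. scale (ring_inverse (of_nat (card G))) (perm_act (h \<circ> g) v)) = proj v"
    unfolding proj_eq by (rule sum.reindex_bij_betw)
  then show ?thesis by (simp add: proj_eq perm_act_sum perm_act_scale perm_act_comp assms)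
qed

lemma perm_act_theta_space: "u \<in> T \<Longrightarrow> g \<in> G \<Longrightarrow> perm_act g u = u"
  by (auto simp: theta_image_def perm_act_proj)

text \<open>G fixes T pointwise, so the group ring acts there through its augmentation; theta has
  augmentation 1.\<close>

lemma group_ring_act_theta_space: "u \<in> T \<Longrightarrow> group_ring_act smul G a u = scale (\<Sum>g\<in>G. a g) u"
  by (simp add: group_ring_act_def perm_act_theta_space vecs.smul_sum_left)

lemma proj_theta_space: "u \<in> T \<Longrightarrow> proj u = u"
  by (simp add: group_ring_act_theta_space theta_def ring_inverse_mult[OF card_G_unit] vecs.smul_one)

lemma proj_scale: "proj (scale r v) = scale r (proj v)"
  by (simp add: proj_eq perm_act_scale vecs.smul_smul vecs.smul_sum_right
      ring_inverse_of_nat_commute[OF card_G_unit])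

lemma proj_add: "proj (u + v) = proj u + proj v"
  by (simp add: proj_eq perm_act_def vec_eq_iff vec_smul_def smul_add_right sum.distrib)

lemma proj_in: "proj v \<in> T"
  by (simp add: theta_image_def)

lemma theta_image_subset: "theta_image smul G C \<subseteq> T"
  by (auto simp: theta_image_def)

text \<open>Theta is R-linear, so its image is a submodule. In this form
  \<open>tensor_act_pure\<close> becomes available for the tensor square of T.\<close>

lemma act_set_theta_space: "act_set scale T"
proof
  have "proj 0 = 0" by (simp add: proj_eq perm_act_def vec_smul_def vec_eq_iff)
  then show "0 \<in> T" using proj_in[of 0] by simp
  show "a + a' \<in> T" if "a \<in> T" "a' \<in> T" for a a'
    using that proj_add[symmetric] by (auto simp: theta_image_def)
  show "scale r a \<in> T" if "a \<in> T" for a r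
    using that proj_scale[symmetric] by (auto simp: theta_image_def)
qed

lemma cyclic_subset_theta_space: "u \<in> T \<Longrightarrow> range (\<lambda>r. scale r u) \<subseteq> T"
  using act_set.A_smul[OF act_set_theta_space] by blast

lemma cyclic_G_code:
  assumes "u \<in> T"
  shows "G_code smul G (range (\<lambda>r. scale r u))"
  unfolding G_code_def
proof (intro conjI ballI)
  show "0 \<in> range (\<lambda>r. scale r u)" by (rule range_eqI[of _ _ 0]) simp
next
  fix v w assume "v \<in> range (\<lambda>r. scale r u)" "w \<in> range (\<lambda>r. scale r u)"
  then show "v + w \<in> range (\<lambda>r. scale r u)" by (auto simp flip: vecs.smul_add_left)
next
  fix a :: "('n \<Rightarrow> 'n) \<Rightarrow> 'r" and v assume "v \<in> range (\<lambda>r. scale r u)"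
  then obtain r where v: "v = scale r u" by blast
  have "group_ring_act smul G a v = scale ((\<Sum>g\<in>G. a g) * r) u"
    unfolding v group_ring_act_theta_space[OF act_set.A_smul[OF act_set_theta_space assms]] vecs.smul_smul ..
  then show "group_ring_act smul G a v \<in> range (\<lambda>r. scale r u)" by simp
qed

lemma theta_image_of_subset:
  assumes "D \<subseteq> T"
  shows "theta_image smul G D = D"
proof -
  have "proj ` D = (\<lambda>u. u) ` D" using assms by (intro image_cong refl proj_theta_space) blast
  then show ?thesis by (simp add: theta_image_def[of _ _ D])
qed

text \<open>R sits inside the group ring as the multiples of the identity permutation.\<close>

lemma G_code_scale:
  assumes "G_code smul G C" "v \<in> C"
  shows "scale r v \<in> C"
proof -
  define a :: "('n \<Rightarrow> 'n) \<Rightarrow> 'r" where "a = (\<lambda>g. if g = id then r else 0)"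
  have "a \<in> group_ring G" using id_in_G by (auto simp: group_ring_def a_def)
  then have "group_ring_act smul G a v \<in> C" using assms by (auto simp: G_code_def)
  moreover have "group_ring_act smul G a v = (\<Sum>g\<in>G. if g = id then scale r v else 0)"
    unfolding group_ring_act_def by (intro sum.cong) (auto simp: a_def perm_act_id)
  ultimately show ?thesis using id_in_G by simp
qed

lemma theta_image_scale:
  "G_code smul G C \<Longrightarrow> u \<in> theta_image smul G C \<Longrightarrow> scale r u \<in> theta_image smul G C"
  unfolding theta_image_def by (auto simp: G_code_scale simp flip: proj_scale)

section \<open>The generators of P in coordinates and the invariant vectors\<close>

lemma m_map_nth:
  assumes rs: "r * s = 1" "s * r = 1" and f: "f \<in> complex_space T"
  shows "m_map smul G r f $ w = f $ scale s w"
proof -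
  have iff: "scale r u = w \<longleftrightarrow> u = scale s w" for u
    using rs by (auto simp: vecs.smul_smul vecs.smul_one)
  have "m_map smul G r f $ w = (\<Sum>u\<in>T. f $ u * (if scale r u = w then 1 else 0))"
    unfolding m_map_def linear_extension_nth[OF f] by (simp add: axis_def eq_commute[of w])
  also have "\<dots> = (\<Sum>u\<in>T. if u = scale s w then f $ u else 0)"
    unfolding iff by (intro sum.cong) auto
  \<comment> \<open>If \<open>scale s w\<close> lies outside T, the sum is 0, which agrees with f
    because f vanishes there.\<close>
  finally show ?thesis using f by (auto simp: complex_space_def)
qed

lemma d_map_nth:
  assumes f: "f \<in> complex_space T"
  shows "d_map smul G \<rho>\<Phi> \<phi> f $ w = qz_exp (\<rho>\<Phi> \<phi> w) * f $ w"
proof -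
  have "d_map smul G \<rho>\<Phi> \<phi> f $ w = (\<Sum>u\<in>T. if u = w then qz_exp (\<rho>\<Phi> \<phi> w) * f $ w else 0)"
    unfolding d_map_def linear_extension_nth[OF f]
    by (intro sum.cong) (simp_all add: axis_def eq_commute[of w])
  then show ?thesis using f by (auto simp: complex_space_def)
qed

lemma m_map_in_space:
  assumes "r * s = 1" "s * r = 1" and f: "f \<in> complex_space T"
  shows "m_map smul G r f \<in> complex_space T"
proof -
  have "w \<in> T" if "scale s w \<in> T" for w
    using act_set.A_smul[OF act_set_theta_space that, of r] assms by (simp add: vecs.smul_smul vecs.smul_one)
  then show ?thesis using f by (auto simp: complex_space_def m_map_nth[OF assms])
qed

lemma m_map_in_GL:
  assumes "r \<in> ring_units"
  shows "m_map smul G r \<in> carrier (GL (complex_space T))"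
proof -
  obtain s where rs: "r * s = 1" "s * r = 1" using assms by (auto simp: ring_units_def)
  have inv: "m_map smul G s (m_map smul G r f) = f"
    if "r * s = 1" "s * r = 1" "f \<in> complex_space T" for r s f
    using that by (simp add: vec_eq_iff m_map_nth[of s r] m_map_nth[of r s] m_map_in_space vecs.smul_smul vecs.smul_one)
  show ?thesis
    unfolding m_map_def
    by (rule linear_extension_in_GL[where h' = "\<lambda>u. basis_vector (vec_smul smul s u)"])
      (fold m_map_def, use rs inv m_map_in_space in auto)
qed

lemma d_map_in_space: "f \<in> complex_space T \<Longrightarrow> d_map smul G \<rho>\<Phi> \<phi> f \<in> complex_space T"
  by (simp add: complex_space_def[of T] d_map_nth[unfolded complex_space_def])

text \<open>For u in T the map from \<phi> to \<open>qz_exp (\<rho>\<Phi> \<phi> u)\<close> turns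
  sums into products, so \<open>- \<phi>\<close> provides the inverse.\<close>

lemma d_map_in_GL:
  fixes \<rho>\<Phi> :: "'p::ab_group_add \<Rightarrow> 'v ^ 'n \<Rightarrow> qz"
  assumes add: "\<And>u \<phi> \<psi>. u \<in> T \<Longrightarrow> \<rho>\<Phi> (\<phi> + \<psi>) u = \<rho>\<Phi> \<phi> u + \<rho>\<Phi> \<psi> u"
  shows "d_map smul G \<rho>\<Phi> \<phi> \<in> carrier (GL (complex_space T))"
proof -
  have "qz_exp (\<rho>\<Phi> \<phi> u) * qz_exp (\<rho>\<Phi> (- \<phi>) u) = 1" if "u \<in> T" for u \<phi>
  proof -
    have "\<rho>\<Phi> 0 u = 0" using add[OF that, of 0 0] by simp
    then show ?thesis using add[OF that, of \<phi> "- \<phi>"] by (simp add: qz_exp_eq_1_iff flip: qz_exp_add)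
  qed
  note unit = this
  have inv: "qz_exp (\<rho>\<Phi> \<phi> u) * (qz_exp (\<rho>\<Phi> (- \<phi>) u) * f $ u) = f $ u" (is ?A)
    "qz_exp (\<rho>\<Phi> (- \<phi>) u) * (qz_exp (\<rho>\<Phi> \<phi> u) * f $ u) = f $ u" (is ?B)
    if "f \<in> complex_space T" for u f
  proof -
    show ?A
    proof (cases "u \<in> T")
      case True
      then show ?thesis using unit[OF True, of \<phi>] by (simp flip: mult.assoc)
    qed (use that in \<open>simp add: complex_space_def\<close>)
    then show ?B by (simp only: mult.left_commute)
  qed
  have "d_map smul G \<rho>\<Phi> \<phi> (d_map smul G \<rho>\<Phi> (- \<phi>) f) = f"
    "d_map smul G \<rho>\<Phi> (- \<phi>) (d_map smul G \<rho>\<Phi> \<phi> f) = f" if "f \<in> complex_space T" for f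
    unfolding vec_eq_iff d_map_nth[OF that] d_map_nth[OF d_map_in_space[OF that]]
    by (intro allI inv that)+
  then show ?thesis
    unfolding d_map_def
    by (intro linear_extension_in_GL[where h' = "\<lambda>u. qz_exp (\<rho>\<Phi> (- \<phi>) u) *s basis_vector u"])
      (fold d_map_def, simp_all add: d_map_in_space)
qed

text \<open>Testing the generators suffices. The second condition may range over all u, also outside
  T, since f vanishes there and units preserve the complement of T.\<close>

lemma invariant_vectors_P_group:
  fixes \<rho>\<Phi> :: "'p::ab_group_add \<Rightarrow> 'v ^ 'n \<Rightarrow> qz"
  assumes add: "\<And>u \<phi> \<psi>. u \<in> T \<Longrightarrow> \<rho>\<Phi> (\<phi> + \<psi>) u = \<rho>\<Phi> \<phi> u + \<rho>\<Phi> \<psi> u"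
  shows "f \<in> invariant_vectors (complex_space T) (P_group smul G \<rho>\<Phi>) \<longleftrightarrow>
    (\<forall>u. u \<notin> {u \<in> T. \<forall>\<phi>. \<rho>\<Phi> \<phi> u = 0} \<longrightarrow> f $ u = 0) \<and> (\<forall>r\<in>ring_units. \<forall>u. f $ scale r u = f $ u)"
    (is "_ \<longleftrightarrow> ?supp \<and> ?inv")
proof
  assume "f \<in> invariant_vectors (complex_space T) (P_group smul G \<rho>\<Phi>)"
  then have W: "f \<in> complex_space T" and m: "\<And>r. r \<in> ring_units \<Longrightarrow> m_map smul G r f = f"
    and d: "\<And>\<phi>. d_map smul G \<rho>\<Phi> \<phi> f = f"
    by (auto simp: invariant_vectors_def P_group_def generate.incl)
  have "\<rho>\<Phi> \<phi> u = 0" if "f $ u \<noteq> 0" for u \<phi>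
    using d_map_nth[OF W, of \<rho>\<Phi> \<phi> u] that by (simp add: d qz_exp_eq_1_iff)
  then have ?supp using W by (auto simp: complex_space_def)
  moreover have "f $ scale r u = f $ u" if r: "r \<in> ring_units" for r u
  proof -
    obtain s where "r * s = 1" "s * r = 1" using r by (auto simp: ring_units_def)
    then show ?thesis using m_map_nth[of r s f "scale r u"] W m[OF r] by (simp add: vecs.smul_smul vecs.smul_one)
  qed
  ultimately show "?supp \<and> ?inv" by blast
next
  assume *: "?supp \<and> ?inv"
  then have W: "f \<in> complex_space T" by (simp add: complex_space_def)
  have "h f = f" if "h \<in> m_map smul G ` ring_units \<union> range (d_map smul G \<rho>\<Phi>)" for h
    using that
  proof (elim UnE imageE)
    fix r assume h: "h = m_map smul G r" and "r \<in> ring_units"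
    then obtain s where rs: "r * s = 1" "s * r = 1" by (auto simp: ring_units_def)
    then have "s \<in> ring_units" by (auto simp: ring_units_def)
    then show ?thesis using * by (simp add: h vec_eq_iff m_map_nth[OF rs W])
  next
    fix \<phi> assume h: "h = d_map smul G \<rho>\<Phi> \<phi>"
    have "qz_exp (\<rho>\<Phi> \<phi> u) * f $ u = f $ u" for u
      using * by (cases "\<rho>\<Phi> \<phi> u = 0") (auto simp: qz_exp_eq_1_iff[THEN iffD2])
    then show ?thesis by (simp add: h vec_eq_iff d_map_nth[OF W])
  qed
  then have "p f = f" if "p \<in> P_group smul G \<rho>\<Phi>" for p
    using generate_GL_fixes[OF subspace_complex_space _ W _ that[unfolded P_group_def]]
      m_map_in_GL d_map_in_GL[of \<rho>\<Phi>, OF add] by blast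
  then show "f \<in> invariant_vectors (complex_space T) (P_group smul G \<rho>\<Phi>)"
    using W by (simp add: invariant_vectors_def)
qed

end

lemma pure_tensor_in_carrier:
  assumes "a \<in> A" "b \<in> B"
  shows "pure_tensor A B a b \<in> carrier (tensor_group A B)"
  using assms by (auto simp: tensor_group_def pure_tensor_def carrier_FactGroup)

theorem theorem1p3:
  fixes smul :: "'r::{ring_1,finite} \<Rightarrow> 'v::{ab_group_add,finite} \<Rightarrow> 'v"
    and G :: "('n::finite \<Rightarrow> 'n) set"
    and t :: nat and \<alpha> :: "nat \<Rightarrow> 'n"
    and mact :: "'m::ab_group_add \<Rightarrow> ('r, 'r) tensor \<Rightarrow> 'm" and \<tau> :: "'m \<Rightarrow> 'm"
    and qact :: "'p::ab_group_add \<Rightarrow> 'r \<Rightarrow> 'p" and brace :: "'m \<Rightarrow> 'p" and lam :: "'p \<Rightarrow> 'm"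
    and \<rho>M :: "'m \<Rightarrow> ('v ^ 'n, 'v ^ 'n) tensor \<Rightarrow> qz"
    and \<rho>\<Phi> :: "'p \<Rightarrow> 'v ^ 'n \<Rightarrow> qz"
  assumes "left_module smul"
    and "subgroup G (BijGroup UNIV)"
    and "(of_nat (card G) :: 'r) \<in> ring_units"
    and "orbit_representatives G t \<alpha>"
    and "quadratic_pair mact \<tau> qact brace lam"
    and "G_representation smul mact \<tau> qact brace lam G t \<alpha> \<rho>M \<rho>\<Phi>"
  shows "vec.span {fwe (theta_image smul G C) | C. G_code smul G C \<and> G_isotropic smul G \<rho>M \<rho>\<Phi> C}
    = invariant_vectors (complex_space (theta_space smul G)) (P_group smul G \<rho>\<Phi>)"
proof -
  interpret permutation_module smul G
    using assms(1-3) by (simp add: permutation_module_def permutation_module_axioms_def)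
  interpret act_set "vec_smul smul :: 'r \<Rightarrow> 'v ^ 'n \<Rightarrow> 'v ^ 'n" T by (rule act_set_theta_space)
  interpret rep: G_representation smul mact \<tau> qact brace lam G t \<alpha> \<rho>M \<rho>\<Phi> by fact
  define S where "S = {u \<in> T. \<forall>\<phi>. \<rho>\<Phi> \<phi> u = 0}"
  let ?I = "invariant_vectors (complex_space T) (P_group smul G \<rho>\<Phi>)"
  let ?X = "{fwe (theta_image smul G C) | C. G_code smul G C \<and> G_isotropic smul G \<rho>M \<rho>\<Phi> C}"
  have I_iff: "f \<in> ?I \<longleftrightarrow> (\<forall>u. u \<notin> S \<longrightarrow> f $ u = 0) \<and> (\<forall>r\<in>ring_units. \<forall>u. f $ scale r u = f $ u)" for f
    unfolding S_def by (rule invariant_vectors_P_group) (rule rep.rhoPhi_add)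
  \<comment> \<open>The value of \<phi> at ru is the value of \<open>qact \<phi> r\<close> at
    u.\<close>
  have S_scale: "scale r u \<in> S" if "u \<in> S" for r u
    using that A_smul by (simp add: S_def flip: rep.rhoPhi_act)
  have cyclic: "fwe (range (\<lambda>r. scale r u)) \<in> ?X" if u: "u \<in> S" for u
  proof -
    have uT: "u \<in> T" using u by (simp add: S_def)
    let ?C = "range (\<lambda>r. scale r u)"
    \<comment> \<open>Isotropy is a condition on the image under theta, which here is the code
      itself.\<close>
    have C: "theta_image smul G ?C = ?C"
      by (intro theta_image_of_subset cyclic_subset_theta_space uT)
    have "\<rho>M m (theta_tensor smul G (scale r u) (scale s u)) = 0" for m r s
    proof -
      have RR: "pure_RR r s \<in> carrier tensor_ring"
        using pure_tensor_in_carrier[of r UNIV s UNIV] by (simp add: tensor_ring_def)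
      have "\<rho>M m (theta_tensor smul G (scale r u) (scale s u))
          = \<rho>M m (tensor_act scale T (pure_RR r s) (theta_tensor smul G u u))"
        by (simp add: tensor_act_pure uT)
      also have "\<dots> = \<rho>M (mact m (pure_RR r s)) (theta_tensor smul G u u)"
        by (rule rep.rhoM_act[symmetric, OF RR]) (intro pure_tensor_in_carrier uT)
      also have "\<dots> = \<rho>\<Phi> (brace (mact m (pure_RR r s))) u" by (simp add: rep.rho_brace uT)
      finally show ?thesis using u by (simp add: S_def)
    qed
    moreover have "\<rho>\<Phi> \<phi> (scale r u) = 0" for \<phi> r using S_scale[OF u] by (simp add: S_def)
    ultimately have "G_isotropic smul G \<rho>M \<rho>\<Phi> ?C" unfolding G_isotropic_def C by blast
    then show ?thesis using cyclic_G_code[OF uT] by (intro CollectI exI[of _ ?C]) (simp only: C simp_thms)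
  qed
  show ?thesis
  proof (intro subset_antisym subsetI)
    fix f assume "f \<in> ?I"
    then have "f \<in> vec.span ((\<lambda>u. fwe (range (\<lambda>r. scale r u))) ` S)"
      unfolding I_iff by (intro span_fwe_cyclic vecs.left_module_axioms S_scale) blast+
    moreover have "(\<lambda>u. fwe (range (\<lambda>r. scale r u))) ` S \<subseteq> ?X" using cyclic by blast
    ultimately show "f \<in> vec.span ?X" using vec.span_mono by blast
  next
    fix f assume f: "f \<in> vec.span ?X"
    \<comment> \<open>Both conditions in \<open>I_iff\<close> are linear in f, so only the spanning
      enumerators have to be tested.\<close>
    have "vec.subspace ?I" by (auto simp: vec.subspace_def I_iff)
    moreover have "fwe (theta_image smul G C) \<in> ?I" if C: "G_code smul G C" "G_isotropic smul G \<rho>M \<rho>\<Phi> C" for C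
    proof -
      let ?D = "theta_image smul G C"
      have "?D \<subseteq> S" using C(2) theta_image_subset[of C] by (auto simp: S_def G_isotropic_def)
      \<comment> \<open>The image of a code under theta is closed under scalars; scaling back by the
        inverse of r gives the converse.\<close>
      moreover have "scale r u \<in> ?D \<longleftrightarrow> u \<in> ?D" if r: "r \<in> ring_units" for r u
      proof -
        obtain s where "s * r = 1" using r by (auto simp: ring_units_def)
        then have "scale s (scale r u) = u" by (simp add: vecs.smul_smul vecs.smul_one)
        then show ?thesis using theta_image_scale[OF C(1)] by metis
      qed
      ultimately show ?thesis unfolding I_iff fwe_nth by auto
    qed
    then have "?X \<subseteq> ?I" by blast
    ultimately show "f \<in> ?I" using f vec.span_minimal by blast
  qed
qed

end
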